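(* Fix an integer $N>0$ and real powers $n_0 < \cdots < n_{N-1} < M$, where $n_j \geqslant 0$ and $n_j \in \mathbb{Z}^{\geqslant 0} \cup [N-2,\infty)$ for all $j$. Also fix real scalars $\rho > 0$ and $c_{n_0}, \dots, c_{n_{N-1}}, c'$, and define $$f(x) := \sum_{j=0}^{N-1} c_{n_j} x^{n_j} + c' x^M .$$ Then the following are equivalent: (1) The entrywise map $f[-]$ preserves total non-negativity on rank-one matrices in $\mathrm{HTN}_N((0,\rho))$. (2) The entrywise map $f[-]$ preserves positivity on rank-one matrices in $\mathrm{HTN}_N((0,\rho))$. (3) Either all $c_{n_j}, c' \geqslant 0$; or $c_{n_j} > 0$ for all $j$ and $c' \geqslant -\mathcal{C}^{-1}$, where $$\mathcal{C} = \sum_{j=0}^{N-1} \frac{V(\mathbf{n}_j)^2}{V(\mathbf{n})^2} \frac{\rho^{M - n_j}}{c_{n_j}},$$ with $\mathbf{n} := (n_0, \dots, n_{N-1})$ and $\mathbf{n}_j := (n_0, \dots, n_{j-1}, n_{j+1}, \dots, n_{N-1}, M)$. (4) The entrywise map $f[-]$ preserves total non-negativity on the set $\mathrm{HTN}_N([0,\rho])$.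
   Context: A real matrix is totally non-negative if all its minors are non-negative. For $I \subset [0,+\infty)$, $\mathrm{HTN}_N(I)$ is the set of $N\times N$ Hankel totally non-negative matrices with entries in $I$ (such matrices are automatically positive semidefinite). For $A=(a_{jk})$ with entries in the domain of $f$, $f[A] := (f(a_{jk}))$. The map $f[-]$ preserves total non-negativity (resp. positivity) on a set of such matrices if $f[A]$ is totally non-negative (resp. positive semidefinite) for every $A$ in the set. Convention: $0^0=1$. For a tuple $(t_0,\dots,t_{k-1})$, $V(t_0,\dots,t_{k-1}) := \prod_{0 \leqslant i < j \leqslant k-1} (t_j - t_i)$ (an empty product is $1$). *)

theory Defs
  imports Jordan_Normal_Form.DL_Rank Jordan_Normal_Form.DL_Submatrix
begin

text \<open>Real powers on \<open>[0, \<infinity>)\<close> with the convention \<open>0\<^sup>0 = 1\<close>; the library's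
  \<open>powr\<close> has \<open>0 powr 0 = 0\<close>.\<close>

definition rpow :: "real \<Rightarrow> real \<Rightarrow> real" where
  "rpow x a = (if x = 0 \<and> a = 0 then 1 else x powr a)"

definition totally_nonneg :: "real mat \<Rightarrow> bool" where
  "totally_nonneg A \<longleftrightarrow>
     (\<forall>I J. I \<subseteq> {..<dim_row A} \<and> J \<subseteq> {..<dim_col A} \<and> card I = card J
        \<longrightarrow> 0 \<le> det (submatrix A I J))"

definition pos_semidef :: "real mat \<Rightarrow> bool" where
  "pos_semidef A \<longleftrightarrow>
     square_mat A \<and> transpose_mat A = A \<and>
     (\<forall>v \<in> carrier_vec (dim_row A). 0 \<le> v \<bullet> (A *\<^sub>v v))"

definition hankel :: "real mat \<Rightarrow> bool" where
  "hankel A \<longleftrightarrow>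
     (\<forall>i<dim_row A. \<forall>j<dim_col A. \<forall>k<dim_row A. \<forall>l<dim_col A.
        i + j = k + l \<longrightarrow> A $$ (i, j) = A $$ (k, l))"

definition HTN :: "nat \<Rightarrow> real set \<Rightarrow> real mat set" where
  "HTN N I = {A \<in> carrier_mat N N. hankel A \<and> totally_nonneg A \<and> elements_mat A \<subseteq> I}"

definition HTN_rank1 :: "nat \<Rightarrow> real set \<Rightarrow> real mat set" where
  "HTN_rank1 N I = {A \<in> HTN N I. vec_space.rank N A = 1}"

definition preserves_TN :: "(real \<Rightarrow> real) \<Rightarrow> real mat set \<Rightarrow> bool" where
  "preserves_TN f S \<longleftrightarrow> (\<forall>A\<in>S. totally_nonneg (map_mat f A))"

definition preserves_positivity :: "(real \<Rightarrow> real) \<Rightarrow> real mat set \<Rightarrow> bool" where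
  "preserves_positivity f S \<longleftrightarrow> (\<forall>A\<in>S. pos_semidef (map_mat f A))"

definition vandermonde :: "real list \<Rightarrow> real" where
  "vandermonde t = (\<Prod>j<length t. \<Prod>i<j. (t ! j - t ! i))"

end

theory Submission
  imports Defs
begin

text \<open>The four conditions are linked in the cycle \<open>cond2\<close>, \<open>cond3\<close>, \<open>cond4\<close>, \<open>cond1\<close>, \<open>cond2\<close>.

  From \<open>cond2\<close> to \<open>cond3\<close>. The matrices \<open>a * r ^ (i + j)\<close> with \<open>0 < r < 1\<close> belong to the test set. If
  \<open>v\<close> is the coefficient vector of a polynomial \<open>q\<close> of degree below \<open>N\<close>, the quadratic form of \<open>f[A]\<close>
  at \<open>v\<close> is the sum of \<open>c j * a powr n j * q (r powr n j)\<^sup>2\<close> over \<open>j\<close>, plus the analogous term for \<open>M\<close>.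
  Letting \<open>q\<close> vanish at suitable nodes \<open>r powr n j\<close> gives the signs of the coefficients
  (\<open>preserver_coefficient_nonneg\<close>, \<open>preserver_coefficient_nonzero\<close>). The threshold appears when the values
  of \<open>q\<close> at the nodes are those of the equality case of the Cauchy-Schwarz inequality, and \<open>r\<close> tends to 1
  while \<open>a\<close> tends to \<open>\<rho>\<close>: the Lagrange coefficients with nodes \<open>r powr n j\<close> tend to those with nodes
  \<open>n j\<close>, and the latter are the ratios of Vandermonde products up to sign (\<open>preserver_threshold\<close>,
  \<open>vandermonde_ratio\<close>).

  From \<open>cond3\<close> to \<open>cond4\<close>. A Hankel matrix is totally non-negative if and only if it and its shift by one
  column (without the last row) are positive semidefinite (\<open>hankel_TN_imp_psd\<close>, \<open>hankel_psd_imp_TN\<close>).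
  One direction is the criterion of principal minors. The other is Fekete's criterion of contiguous
  minors: in a Hankel matrix these are principal minors of the matrix or of its shift. It
  therefore suffices that \<open>f[-]\<close> preserves positivity on all positive semidefinite matrices of size
  \<open>N\<close> with entries in \<open>{0..\<rho>}\<close>. For rank one (\<open>rank_one_psd\<close>) this is interpolation of \<open>x powr M\<close> by
  the other powers at \<open>N\<close> points, together with the Cauchy-Schwarz inequality; the coefficients of the
  interpolant are bounded by a repeated use of Rolle's theorem (\<open>powr_interpolation_bound\<close>), and this
  bound is where the Vandermonde ratios come from. Higher ranks follow by induction on \<open>N\<close> with the
  FitzGerald-Horn principle (\<open>entrywise_psd_extension\<close>): the quadratic form of \<open>f\<close> increases along a
  segment from a rank-one matrix to \<open>A\<close>, because the derivative \<open>f'\<close> preserves positivity in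
  dimension \<open>N - 1\<close>. The condition on the exponents is what this induction needs, and the threshold
  is inherited by the derivative (\<open>rank_one_cost_derivative\<close>).

  From \<open>cond4\<close> to \<open>cond1\<close> the set of matrices shrinks, and \<open>cond1\<close> gives \<open>cond2\<close> because Hankel matrices
  are symmetric and non-negative principal minors make a symmetric matrix positive semidefinite.\<close>

section \<open>Zeros of sums of real powers, and interpolation by them\<close>

text \<open>Rolle's theorem between consecutive zeros. Confining the zeros of the derivative below
  \<open>Max X\<close> is what keeps the interpolation points inside \<open>{0<..R}\<close> when derivatives are taken
  repeatedly.\<close>
lemma Rolle_finite_zeros:
  fixes g g' :: "real \<Rightarrow> real"
  assumes "finite X" "card X = Suc k" "X \<subseteq> {0<..}"
    and der: "\<And>x. x > 0 \<Longrightarrow> (g has_real_derivative g' x) (at x)"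
    and zero: "\<And>x. x \<in> X \<Longrightarrow> g x = 0"
  shows "\<exists>Y. finite Y \<and> card Y = k \<and> Y \<subseteq> {0<..<Max X} \<and> (\<forall>y\<in>Y. g' y = 0)"
  using assms(1-3) zero
proof (induction k arbitrary: X)
  case 0
  then show ?case by (intro exI[of _ "{}"]) auto
next
  case (Suc k)
  define m where "m = Max X"
  have ne: "X \<noteq> {}" using Suc.prems(2) by auto
  have mX: "m \<in> X" using Suc.prems(1) ne by (simp add: m_def)
  define X' where "X' = X - {m}"
  have c': "card X' = Suc k" "finite X'" "X' \<subseteq> {0<..}"
    using Suc.prems mX by (auto simp: X'_def)
  then obtain Y where Y: "finite Y" "card Y = k" "Y \<subseteq> {0<..<Max X'}" "\<forall>y\<in>Y. g' y = 0"
    using Suc.IH[OF c'(2,1,3)] Suc.prems(4) unfolding X'_def by (metis DiffD1)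
  have ne': "X' \<noteq> {}" using c'(1) by auto
  have m'X: "Max X' \<in> X'" using c' ne' by simp
  have lt: "Max X' < m"
  proof -
    have "Max X' \<noteq> m" using m'X unfolding X'_def by blast
    moreover have "Max X' \<in> X" using m'X unfolding X'_def by blast
    then have "Max X' \<le> m" unfolding m_def using Suc.prems(1) by (rule Max_ge[rotated])
    ultimately show ?thesis by linarith
  qed
  have pos: "Max X' > 0" using m'X c'(3) by auto
  have "\<exists>z. Max X' < z \<and> z < m \<and> g' z = 0"
  proof -
    have "\<exists>z>Max X'. z < m \<and> (*) (g' z) = (\<lambda>v. 0)"
    proof (rule Rolle_deriv[OF lt])
      have "Max X' \<in> X" using m'X unfolding X'_def by blast
      then show "g (Max X') = g m" using Suc.prems(4) mX by simp
      show "continuous_on {Max X'..m} g"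
        using pos by (intro continuous_at_imp_continuous_on ballI DERIV_isCont[OF der]) auto
      fix x assume "Max X' < x" "x < m"
      then have "(g has_real_derivative g' x) (at x)" using pos by (intro der) auto
      then show "(g has_derivative (*) (g' x)) (at x)"
        by (simp add: has_field_derivative_def)
    qed
    then obtain z where z: "Max X' < z" "z < m" "(*) (g' z) = (\<lambda>v. 0)" by blast
    from fun_cong[OF z(3), of 1] z(1,2) show ?thesis by auto
  qed
  then obtain z where z: "Max X' < z" "z < m" "g' z = 0" by blast
  have "z \<notin> Y" using Y(3) z(1) by auto
  then show ?case
    using Y z pos lt unfolding m_def[symmetric]
    by (intro exI[of _ "insert z Y"]) (auto dest!: subsetD)
qed

lemma powr_sum_deriv:
  fixes e :: "nat \<Rightarrow> real"
  assumes "x > 0"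
  shows "((\<lambda>x. \<Sum>j\<in>J. a j * x powr e j) has_real_derivative
      (\<Sum>j\<in>J. a j * (e j * x powr (e j - 1)))) (at x)"
  using assms by (auto intro!: derivative_eq_intros sum.cong)

text \<open>Descartes' bound: a nonzero combination of \<open>k\<close> real powers has fewer than \<open>k\<close> zeros on the
  positive half-line. Dividing by one of the powers turns its term into a constant, so that
  differentiation removes it and Rolle's theorem loses only one zero.\<close>
lemma powr_sum_zeros:
  fixes e a :: "nat \<Rightarrow> real"
  assumes "finite J" "inj_on e J" "finite X" "card X = card J" "X \<subseteq> {0<..}"
    and "\<And>x. x \<in> X \<Longrightarrow> (\<Sum>j\<in>J. a j * x powr e j) = 0"
  shows "\<forall>j\<in>J. a j = 0"
  using assms
proof (induction J arbitrary: X a rule: finite_induct)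
  case empty
  then show ?case by simp
next
  case (insert i J)
  define g where "g = (\<lambda>x. a i + (\<Sum>j\<in>J. a j * x powr (e j - e i)))"
  define g' where "g' = (\<lambda>x. \<Sum>j\<in>J. a j * ((e j - e i) * x powr (e j - e i - 1)))"
  have Xpos: "x > 0" if "x \<in> X" for x using insert.prems that by auto
  have gz: "g x = 0" if "x \<in> X" for x
  proof -
    have "g x * x powr e i = 0"
      using insert.prems(5)[OF that] Xpos[OF that] insert.hyps
      by (simp add: g_def distrib_right left_diff_distrib sum_distrib_right mult.assoc powr_add[symmetric])
    then show ?thesis using Xpos[OF that] by simp
  qed
  have gd: "(g has_real_derivative g' x) (at x)" if "x > 0" for x
    unfolding g_def g'_def using DERIV_add[OF DERIV_const powr_sum_deriv[OF that]] by simp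
  have "card X = Suc (card J)" using insert by simp
  then obtain Y where Y: "finite Y" "card Y = card J" "Y \<subseteq> {0<..<Max X}" "\<forall>y\<in>Y. g' y = 0"
    using Rolle_finite_zeros[OF insert.prems(2) _ insert.prems(4) gd gz] by blast
  have "\<forall>j\<in>J. a j * (e j - e i) = 0"
  proof (rule insert.IH)
    show "inj_on e J" using insert.prems by auto
    show "finite Y" "card Y = card J" "Y \<subseteq> {0<..}" using Y by auto
    fix y assume y: "y \<in> Y"
    then have "y > 0" using Y by auto
    have "y powr (e i + 1) * y powr (e j - e i - 1) = y powr e j" for j
      by (simp add: powr_add[symmetric])
    then have "(\<Sum>j\<in>J. a j * (e j - e i) * y powr e j) = y powr (e i + 1) * g' y"
      unfolding g'_def by (simp add: sum_distrib_left mult.left_commute mult.assoc)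
    then show "(\<Sum>j\<in>J. a j * (e j - e i) * y powr e j) = 0" using Y y by simp
  qed
  moreover have "e j \<noteq> e i" if "j \<in> J" for j
    using insert.prems(1) insert.hyps(2) that by (auto simp: inj_on_def)
  ultimately have a0: "\<forall>j\<in>J. a j = 0" by auto
  have "X \<noteq> {}" using insert by auto
  then obtain x where "x \<in> X" by blast
  with gz[of x] a0 have "a i = 0" by (simp add: g_def)
  with a0 show ?case by simp
qed

text \<open>Newton-style construction: an interpolant on all points but one is corrected by a function
  that vanishes on those points, and Descartes' bound says that this function does not vanish at
  the remaining point.\<close>
lemma powr_interpolation:
  fixes e :: "nat \<Rightarrow> real" and h :: "real \<Rightarrow> real"
  assumes "finite J" "inj_on e J" "finite X" "card X = card J" "X \<subseteq> {0<..}"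
  shows "\<exists>a. \<forall>x\<in>X. (\<Sum>j\<in>J. a j * x powr e j) = h x"
  using assms
proof (induction J arbitrary: X h rule: finite_induct)
  case empty
  then show ?case by simp
next
  case (insert i J)
  have "X \<noteq> {}" using insert by auto
  then obtain x0 where x0: "x0 \<in> X" by blast
  define X' where "X' = X - {x0}"
  have X': "finite X'" "card X' = card J" "X' \<subseteq> {0<..}" "inj_on e J"
    using insert x0 by (auto simp: X'_def)
  obtain b where b: "\<forall>x\<in>X'. (\<Sum>j\<in>J. b j * x powr e j) = h x"
    using insert.IH[OF X'(4,1-3)] by blast
  obtain d where d: "\<forall>x\<in>X'. (\<Sum>j\<in>J. d j * x powr e j) = x powr e i"
    using insert.IH[OF X'(4,1-3), of "\<lambda>x. x powr e i"] by blast
  define P where "P = (\<lambda>d x. \<Sum>j\<in>J. d j * x powr e j)"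
  have upd: "(\<Sum>j\<in>insert i J. (f(i := t)) j * x powr e j) = t * x powr e i + P f x" for f t x
  proof -
    have "(\<Sum>j\<in>J. (f(i := t)) j * x powr e j) = P f x"
      unfolding P_def using insert.hyps by (intro sum.cong) auto
    then show ?thesis using insert.hyps by simp
  qed
  have nz: "x0 powr e i - P d x0 \<noteq> 0"
  proof
    assume 0: "x0 powr e i - P d x0 = 0"
    have "\<forall>j\<in>insert i J. ((\<lambda>j. - d j)(i := 1)) j = 0"
    proof (rule powr_sum_zeros)
      fix x assume "x \<in> X"
      then have "x powr e i - P d x = 0" using d 0 by (cases "x = x0") (auto simp: X'_def P_def)
      then show "(\<Sum>j\<in>insert i J. ((\<lambda>j. - d j)(i := 1)) j * x powr e j) = 0"
        unfolding upd by (simp add: P_def sum_negf)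
    qed (use insert in auto)
    then show False by auto
  qed
  define t where "t = (h x0 - P b x0) / (x0 powr e i - P d x0)"
  have Pl: "P (\<lambda>j. b j - t * d j) x = P b x - t * P d x" for x
    by (simp add: P_def sum_subtractf algebra_simps sum_distrib_left)
  show ?case
  proof (intro exI ballI)
    fix x assume "x \<in> X"
    show "(\<Sum>j\<in>insert i J. ((\<lambda>j. b j - t * d j)(i := t)) j * x powr e j) = h x"
    proof (cases "x = x0")
      case True
      have "t * x0 powr e i + (P b x0 - t * P d x0) = P b x0 + t * (x0 powr e i - P d x0)"
        by (simp add: algebra_simps)
      also have "\<dots> = h x0" using nz by (simp add: t_def)
      finally show ?thesis using True by (simp only: upd Pl)
    next
      case False
      then have "x \<in> X'" using \<open>x \<in> X\<close> by (simp add: X'_def)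
      then have "P b x = h x" "P d x = x powr e i" using b d by (auto simp: P_def)
      then show ?thesis by (simp only: upd Pl)
    qed
  qed
qed

text \<open>The value at \<open>t\<close> of the \<open>k\<close>-th Lagrange basis polynomial with nodes \<open>x i\<close>, \<open>i \<in> J\<close>. It is
  used both with the exponents as nodes, where it is a ratio of Vandermonde products up to sign,
  and with the powers \<open>r powr n i\<close> as nodes.\<close>
definition lagrange :: "nat set \<Rightarrow> (nat \<Rightarrow> real) \<Rightarrow> nat \<Rightarrow> real \<Rightarrow> real" where
  "lagrange J x k t = (\<Prod>i\<in>J-{k}. (t - x i) / (x k - x i))"

text \<open>If \<open>x powr M\<close> is interpolated by the powers \<open>x powr e j\<close> at as many points of \<open>{0<..R}\<close>,
  the coefficients are largest in absolute value in the limit where all points merge at \<open>R\<close>; the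
  right-hand side is that limit. Dividing the interpolation error by \<open>x powr e i\<close> for some
  \<open>i \<noteq> k\<close>, differentiating and applying Rolle's theorem gives an interpolation problem without the
  exponent \<open>e i\<close>, and divides the \<open>k\<close>-th coefficient, up to sign, by the factor of index \<open>i\<close> of
  the bound. In the end a single power is left, and the bound is monotonicity.\<close>
lemma powr_interpolation_bound:
  fixes e a :: "nat \<Rightarrow> real"
  assumes "finite J" "inj_on e J" "\<And>j. j \<in> J \<Longrightarrow> e j < M" "finite X" "card X = card J" "X \<subseteq> {0<..R}"
    and "\<And>x. x \<in> X \<Longrightarrow> (\<Sum>j\<in>J. a j * x powr e j) = x powr M" "k \<in> J"
  shows "\<bar>a k\<bar> \<le> \<bar>lagrange J e k M\<bar> * R powr (M - e k)"
  unfolding lagrange_def abs_prod using assms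
proof (induction "card J" arbitrary: J X a)
  case 0
  then show ?case by auto
next
  case (Suc n)
  have Xpos: "x > 0" "x \<le> R" if "x \<in> X" for x using Suc.prems that by auto
  have "X \<noteq> {}" using Suc by auto
  then obtain x0 where x0: "x0 \<in> X" by blast
  show ?case
  proof (cases "J = {k}")
    case True
    then have "a k * x0 powr e k = x0 powr M" using Suc.prems(7)[OF x0] by simp
    then have "a k = x0 powr (M - e k)" using Xpos[OF x0] by (simp add: powr_diff field_simps)
    also have "\<dots> \<le> R powr (M - e k)"
      using Xpos[OF x0] Suc.prems(3)[of k] Suc.prems(8) by (intro powr_mono2) auto
    finally have "\<bar>a k\<bar> \<le> R powr (M - e k)"
      using \<open>a k = _\<close> by simp
    then show ?thesis using True by simp
  next
    case False
    then obtain i where i: "i \<in> J" "i \<noteq> k" using Suc.prems(8) by blast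
    define K where "K = J - {i}"
    have J: "J = insert i K" "i \<notin> K" "finite K" using i Suc.prems(1) by (auto simp: K_def)
    define g where "g = (\<lambda>x. (\<Sum>j\<in>K. a j * x powr (e j - e i)) + (a i - x powr (M - e i)))"
    define g' where "g' = (\<lambda>x. (\<Sum>j\<in>K. a j * ((e j - e i) * x powr (e j - e i - 1)))
       + (0 - (M - e i) * x powr (M - e i - 1)))"
    have gz: "g x = 0" if "x \<in> X" for x
    proof -
      have "(\<Sum>j\<in>K. a j * x powr e j) + a i * x powr e i = x powr M"
        using Suc.prems(7)[OF that] unfolding J(1) using J(2,3) by simp
      then have "g x * x powr e i = 0"
        using Xpos[OF that]
        by (simp add: g_def distrib_right left_diff_distrib sum_distrib_right mult.assoc powr_add[symmetric])
      then show ?thesis using Xpos[OF that] by simp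
    qed
    have gd: "(g has_real_derivative g' x) (at x)" if "x > 0" for x
      unfolding g_def g'_def
      by (intro DERIV_add powr_sum_deriv DERIV_diff DERIV_const that
            has_real_derivative_powr)
    have "card X = Suc (card K)" using Suc.prems J by simp
    moreover have "X \<subseteq> {0<..}" using Xpos(1) by auto
    ultimately obtain Y where Y: "finite Y" "card Y = card K" "Y \<subseteq> {0<..<Max X}" "\<forall>y\<in>Y. g' y = 0"
      using Rolle_finite_zeros[OF Suc.prems(4) _ _ gd gz] by blast
    have mR: "Max X \<le> R" using Suc.prems(4,6) \<open>X \<noteq> {}\<close> by auto
    have Mi: "M - e i > 0" using Suc.prems(3) i by simp
    (* The coefficients of the interpolation problem that the zeros of g' solve. *)
    define b where "b = (\<lambda>j. a j * (e j - e i) / (M - e i))"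
    have "\<bar>b k\<bar> \<le> (\<Prod>i\<in>K-{k}. \<bar>(M - e i) / (e k - e i)\<bar>) * R powr (M - e k)"
    proof (rule Suc.hyps(1))
      show "n = card K" using Suc.hyps(2) J by simp
      show "inj_on e K" using Suc.prems(2) J by auto
      show "Y \<subseteq> {0<..R}" using Y mR by auto
      show "k \<in> K" using i Suc.prems(8) by (simp add: K_def)
      fix y assume y: "y \<in> Y"
      then have "y > 0" using Y by auto
      have pw: "y powr (e i + 1) * y powr (t - e i - 1) = y powr t" for t
        by (simp add: powr_add[symmetric])
      have "y powr (e i + 1) * g' y = (\<Sum>j\<in>K. a j * (e j - e i) * y powr e j) - (M - e i) * y powr M"
        unfolding g'_def by (simp add: sum_distrib_left right_diff_distrib[where a = "y powr (e i + 1)"]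
              mult.left_commute mult.assoc pw)
      then have "(\<Sum>j\<in>K. a j * (e j - e i) * y powr e j) = (M - e i) * y powr M" using Y y by simp
      then show "(\<Sum>j\<in>K. b j * y powr e j) = y powr M"
        unfolding b_def using Mi by (simp add: sum_divide_distrib[symmetric])
    qed (use Suc.prems Y J in auto)
    then have "\<bar>b k\<bar> * \<bar>(M - e i) / (e k - e i)\<bar>
        \<le> (\<Prod>i\<in>K-{k}. \<bar>(M - e i) / (e k - e i)\<bar>) * R powr (M - e k) * \<bar>(M - e i) / (e k - e i)\<bar>"
      by (intro mult_right_mono) auto
    moreover have ne: "e k \<noteq> e i" using Suc.prems(2,8) i by (auto simp: inj_on_def)
    have "\<bar>a k\<bar> = \<bar>b k\<bar> * \<bar>(M - e i) / (e k - e i)\<bar>"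
      using Mi ne by (simp add: b_def abs_mult)
    moreover have "(\<Prod>i\<in>J-{k}. \<bar>(M - e i) / (e k - e i)\<bar>)
        = \<bar>(M - e i) / (e k - e i)\<bar> * (\<Prod>i\<in>K-{k}. \<bar>(M - e i) / (e k - e i)\<bar>)"
    proof -
      have "J - {k} = insert i (K - {k})" using i J by auto
      then show ?thesis using J by (simp only: prod.insert finite_Diff Diff_iff simp_thms)
    qed
    ultimately show ?thesis by (simp only: ac_simps)
  qed
qed

section \<open>Positive semidefinite forms on finite index sets\<close>

definition qform :: "'i set \<Rightarrow> ('i \<Rightarrow> 'i \<Rightarrow> real) \<Rightarrow> ('i \<Rightarrow> real) \<Rightarrow> real" where
  "qform S A v = (\<Sum>i\<in>S. \<Sum>j\<in>S. v i * v j * A i j)"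

definition psd :: "'i set \<Rightarrow> ('i \<Rightarrow> 'i \<Rightarrow> real) \<Rightarrow> bool" where
  "psd S A \<longleftrightarrow> (\<forall>i\<in>S. \<forall>j\<in>S. A i j = A j i) \<and> (\<forall>v. 0 \<le> qform S A v)"

lemma psdI:
  "(\<And>i j. i \<in> S \<Longrightarrow> j \<in> S \<Longrightarrow> A i j = A j i) \<Longrightarrow> (\<And>v. 0 \<le> qform S A v) \<Longrightarrow> psd S A"
  unfolding psd_def by blast

lemma psd_sym: "psd S A \<Longrightarrow> i \<in> S \<Longrightarrow> j \<in> S \<Longrightarrow> A i j = A j i"
  unfolding psd_def by blast

lemma psd_qform: "psd S A \<Longrightarrow> 0 \<le> qform S A v"
  unfolding psd_def by blast

lemma psd_cong:
  assumes eq: "\<And>i j. i \<in> S \<Longrightarrow> j \<in> S \<Longrightarrow> A i j = B i j"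
  shows "psd S A \<longleftrightarrow> psd S B"
proof -
  have "qform S A = qform S B" by (intro ext) (simp add: qform_def eq)
  moreover have "(\<forall>i\<in>S. \<forall>j\<in>S. A i j = A j i) \<longleftrightarrow> (\<forall>i\<in>S. \<forall>j\<in>S. B i j = B j i)"
    by (intro ball_cong refl) (simp add: eq)
  ultimately show ?thesis by (simp add: psd_def)
qed

lemma qform_add: "qform S (\<lambda>i j. A i j + B i j) v = qform S A v + qform S B v"
  by (simp add: qform_def distrib_left sum.distrib)

lemma qform_scale: "qform S (\<lambda>i j. c * A i j) v = c * qform S A v"
  by (simp add: qform_def sum_distrib_left mult.left_commute)

lemma qform_sum: "qform S (\<lambda>i j. \<Sum>k\<in>K. A k i j) v = (\<Sum>k\<in>K. qform S (A k) v)"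
proof -
  have "qform S (\<lambda>i j. \<Sum>k\<in>K. A k i j) v = (\<Sum>i\<in>S. \<Sum>j\<in>S. \<Sum>k\<in>K. v i * v j * A k i j)"
    by (simp add: qform_def sum_distrib_left)
  also have "\<dots> = (\<Sum>i\<in>S. \<Sum>k\<in>K. \<Sum>j\<in>S. v i * v j * A k i j)"
    by (intro sum.cong refl sum.swap)
  also have "\<dots> = (\<Sum>k\<in>K. \<Sum>i\<in>S. \<Sum>j\<in>S. v i * v j * A k i j)" by (rule sum.swap)
  finally show ?thesis by (simp add: qform_def)
qed

lemma qform_outer: "qform S (\<lambda>i j. u i * u j) v = (\<Sum>i\<in>S. v i * u i)\<^sup>2"
  by (simp add: qform_def power2_eq_square sum_product mult.assoc mult.left_commute)

lemma qform_zero_row: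
  assumes "finite S" "T \<subseteq> S" "\<And>i j. i \<in> S - T \<Longrightarrow> j \<in> S \<Longrightarrow> A i j = 0 \<and> A j i = 0"
  shows "qform S A v = qform T A v"
proof -
  have "qform S A v = (\<Sum>i\<in>T. \<Sum>j\<in>S. v i * v j * A i j)"
    unfolding qform_def using assms by (intro sum.mono_neutral_right) auto
  also have "\<dots> = qform T A v"
    unfolding qform_def using assms by (intro sum.cong refl sum.mono_neutral_right) auto
  finally show ?thesis .
qed

lemma psd_add: "psd S A \<Longrightarrow> psd S B \<Longrightarrow> psd S (\<lambda>i j. A i j + B i j)"
  by (simp add: psd_def qform_add)

lemma psd_scale: "psd S A \<Longrightarrow> 0 \<le> c \<Longrightarrow> psd S (\<lambda>i j. c * A i j)"
  by (simp add: psd_def qform_scale)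

lemma psd_outer: "psd S (\<lambda>i j. u i * u j)"
  by (simp add: psd_def qform_outer mult.commute)

lemma psd_sum: "(\<And>k. k \<in> K \<Longrightarrow> psd S (A k)) \<Longrightarrow> psd S (\<lambda>i j. \<Sum>k\<in>K. A k i j)"
  unfolding psd_def by (auto simp: qform_sum intro!: sum_nonneg sum.cong)

lemma psd_zero_row:
  assumes "finite S" "T \<subseteq> S" "\<And>i j. i \<in> S - T \<Longrightarrow> j \<in> S \<Longrightarrow> A i j = 0 \<and> A j i = 0"
  shows "psd S A \<longleftrightarrow> psd T A"
proof -
  have "qform S A = qform T A"
    using assms by (intro ext qform_zero_row) auto
  moreover have "(\<forall>i\<in>S. \<forall>j\<in>S. A i j = A j i) \<longleftrightarrow> (\<forall>i\<in>T. \<forall>j\<in>T. A i j = A j i)"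
    using assms(2,3) by (metis DiffI subsetD)
  ultimately show ?thesis by (simp add: psd_def)
qed

lemma psd_subset:
  assumes "psd S A" "finite S" "T \<subseteq> S"
  shows "psd T A"
proof -
  have "0 \<le> qform T A v" for v
  proof -
    define w where "w = (\<lambda>i. if i \<in> T then v i else 0)"
    have "qform S A w = (\<Sum>i\<in>T. \<Sum>j\<in>S. w i * w j * A i j)"
      unfolding qform_def using assms by (intro sum.mono_neutral_right) (auto simp: w_def)
    also have "\<dots> = (\<Sum>i\<in>T. \<Sum>j\<in>T. w i * w j * A i j)"
      using assms by (intro sum.cong refl sum.mono_neutral_right) (auto simp: w_def)
    also have "\<dots> = qform T A v" unfolding qform_def by (intro sum.cong) (auto simp: w_def)
    finally show ?thesis using psd_qform[OF assms(1)] by metis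
  qed
  then show ?thesis using assms(1,3) unfolding psd_def by blast
qed

lemma psd_reindex:
  assumes "inj_on h T"
  shows "psd (h ` T) A \<longleftrightarrow> psd T (\<lambda>i j. A (h i) (h j))"
proof -
  have q: "qform (h ` T) A v = qform T (\<lambda>i j. A (h i) (h j)) (v \<circ> h)" for v
    using assms by (simp add: qform_def sum.reindex)
  have q': "qform T (\<lambda>i j. A (h i) (h j)) v = qform (h ` T) A (v \<circ> inv_into T h)" for v
    unfolding q using assms by (simp add: qform_def)
  have "(\<forall>v. 0 \<le> qform (h ` T) A v) \<longleftrightarrow> (\<forall>v. 0 \<le> qform T (\<lambda>i j. A (h i) (h j)) v)"
  proof (intro iffI allI)
    fix v assume "\<forall>v. 0 \<le> qform (h ` T) A v"
    then show "0 \<le> qform T (\<lambda>i j. A (h i) (h j)) v" unfolding q' by blast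
  next
    fix v assume "\<forall>v. 0 \<le> qform T (\<lambda>i j. A (h i) (h j)) v"
    then show "0 \<le> qform (h ` T) A v" unfolding q by blast
  qed
  then show ?thesis by (simp add: psd_def)
qed

lemma psd_diag:
  assumes "psd S A" "finite S" "i \<in> S"
  shows "0 \<le> A i i"
proof -
  have "0 \<le> qform {i} A (\<lambda>_. 1)"
    using psd_subset[of S A "{i}"] assms by (simp add: psd_def)
  then show ?thesis by (simp add: qform_def)
qed

lemma psd_two_indices:
  assumes "psd S A" "finite S" "i \<in> S" "j \<in> S" "i \<noteq> j"
  shows "0 \<le> x\<^sup>2 * A i i + 2 * x * y * A i j + y\<^sup>2 * A j j"
proof -
  have "psd {i, j} A" using assms by (auto intro: psd_subset[OF assms(1,2)])
  then have "0 \<le> qform {i, j} A (\<lambda>k. if k = i then x else y)" by (rule psd_qform)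
  moreover have sym: "A j i = A i j" by (rule psd_sym[OF assms(1,4,3)])
  have "qform {i, j} A (\<lambda>k. if k = i then x else y)
      = x\<^sup>2 * A i i + x * y * A i j + (x * y * A j i + y\<^sup>2 * A j j)"
    using assms(5) by (auto simp: qform_def power2_eq_square)
  ultimately show ?thesis unfolding sym by linarith
qed

lemma psd_zero_diag:
  assumes "psd S A" "finite S" "i \<in> S" "j \<in> S" "A i i = 0"
  shows "A i j = 0"
proof (cases "i = j")
  case False
  show ?thesis
  proof (rule ccontr)
    assume ne: "A i j \<noteq> 0"
    have "0 \<le> 2 * x * A i j + A j j" for x
      using psd_two_indices[OF assms(1-4) False, of x 1] assms(5) by simp
    (* At this x the right-hand side is -1. *)
    from this[of "- (A j j + 1) / (2 * A i j)"] show False using ne by (simp add: field_simps)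
  qed
qed (use assms in simp)

text \<open>Completing the square in the variable \<open>s\<close>.\<close>
lemma qform_schur:
  assumes "finite S" "s \<in> S" "A s s \<noteq> 0" "\<And>i. i \<in> S \<Longrightarrow> A s i = A i s"
  shows "qform S A v = (\<Sum>i\<in>S. v i * A i s)\<^sup>2 / A s s + qform (S - {s}) (\<lambda>i j. A i j - A i s * A j s / A s s) v"
proof -
  define B where "B = (\<lambda>i j. A i j - A i s * A j s / A s s)"
  have "qform S A v = qform S (\<lambda>i j. (1 / A s s) * (A i s * A j s) + B i j) v"
    by (simp add: qform_def B_def)
  also have "\<dots> = (\<Sum>i\<in>S. v i * A i s)\<^sup>2 / A s s + qform S B v"
    unfolding qform_add qform_scale qform_outer by simp
  also have "qform S B v = qform (S - {s}) B v"
  proof (rule qform_zero_row)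
    fix i j assume "i \<in> S - (S - {s})" and j: "j \<in> S"
    then have "i = s" using assms(2) by blast
    then show "B i j = 0 \<and> B j i = 0" using assms(3) by (simp add: B_def assms(4)[OF j])
  qed (use assms(1) in auto)
  finally show ?thesis by (simp add: B_def)
qed

text \<open>A vector on \<open>S - {s}\<close> is extended to \<open>s\<close> by the value that makes the completed square
  vanish.\<close>
lemma psd_schur:
  assumes "psd S A" "finite S" "s \<in> S" "A s s > 0"
  shows "psd (S - {s}) (\<lambda>i j. A i j - A i s * A j s / A s s)"
proof -
  define B where "B = (\<lambda>i j. A i j - A i s * A j s / A s s)"
  have sym: "A i j = A j i" if "i \<in> S" "j \<in> S" for i j by (rule psd_sym[OF assms(1) that])
  have "0 \<le> qform (S - {s}) B v" for v
  proof -
    (* The value at s that annihilates the completed square. *)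
    define t where "t = - (\<Sum>i\<in>S-{s}. v i * A i s) / A s s"
    have "(\<Sum>i\<in>S. (v(s := t)) i * A i s) = t * A s s + (\<Sum>i\<in>S-{s}. v i * A i s)"
      using assms(2,3) by (subst sum.remove[of _ s]) (auto intro!: sum.cong)
    also have "\<dots> = 0" using assms(4) by (simp add: t_def)
    finally have 0: "(\<Sum>i\<in>S. (v(s := t)) i * A i s) = 0" .
    have "qform S A (v(s := t)) = qform (S - {s}) B (v(s := t))"
      using qform_schur[where A = A and v = "v(s := t)", OF assms(2,3) less_imp_neq[OF assms(4), symmetric]
          sym[OF assms(3)]] unfolding 0 B_def by simp
    also have "\<dots> = qform (S - {s}) B v" unfolding qform_def by (intro sum.cong refl) auto
    finally show ?thesis using psd_qform[OF assms(1)] by metis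
  qed
  moreover have "B i j = B j i" if "i \<in> S" "j \<in> S" for i j
    using sym[OF that] by (simp add: B_def mult.commute)
  ultimately show ?thesis unfolding psd_def B_def by blast
qed

text \<open>The Schur product theorem, without factorizing \<open>A\<close>: one step of Gaussian elimination writes
  \<open>A\<close> as a rank-one matrix plus a matrix whose row \<open>s\<close> is zero. The entrywise product with the
  rank-one part is a rescaling of \<open>B\<close>, and the rest is a product on fewer indices.\<close>
lemma psd_hadamard:
  assumes "finite S" "psd S A" "psd S B"
  shows "psd S (\<lambda>i j. A i j * B i j)"
  using assms
proof (induction S arbitrary: A B rule: finite_psubset_induct)
  case (psubset S)
  show ?case
  proof (cases "S = {}")
    case True
    then show ?thesis by (simp add: psd_def qform_def)
  next
    case False
    then obtain s where s: "s \<in> S" by blast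
    have sub: "S - {s} \<subset> S" using s by blast
    have symA: "A i j = A j i" if "i \<in> S" "j \<in> S" for i j by (rule psd_sym[OF psubset.prems(1) that])
    show ?thesis
    proof (cases "A s s = 0")
      case True
      have "A s i = 0 \<and> A i s = 0" if "i \<in> S" for i
        using psd_zero_diag[OF psubset.prems(1) psubset.hyps(1) s that True] symA[OF s that] by simp
      then have "psd S (\<lambda>i j. A i j * B i j) \<longleftrightarrow> psd (S - {s}) (\<lambda>i j. A i j * B i j)"
        using psubset.hyps by (intro psd_zero_row) auto
      then show ?thesis
        using psubset.IH[OF sub psd_subset[OF psubset.prems(1)] psd_subset[OF psubset.prems(2)]]
          psubset.hyps by blast
    next
      case False
      then have pos: "A s s > 0" using psd_diag[OF psubset.prems(1) psubset.hyps(1) s] by simp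
      define C where "C = (\<lambda>i j. A i j - A i s * A j s / A s s)"
      have "psd (S - {s}) (\<lambda>i j. C i j * B i j)"
        using psubset.IH[OF sub psd_schur[OF psubset.prems(1) psubset.hyps(1) s pos]
            psd_subset[OF psubset.prems(2) psubset.hyps(1)]] by (simp add: C_def)
      moreover have "C s i = 0 \<and> C i s = 0" if "i \<in> S" for i
        using pos by (simp add: C_def symA[OF s that])
      ultimately have "psd S (\<lambda>i j. C i j * B i j)"
        using psubset.hyps by (subst psd_zero_row[of S "S - {s}"]) auto
      moreover have "psd S (\<lambda>i j. (A i s * A j s) * B i j)"
      proof -
        have "qform S (\<lambda>i j. (A i s * A j s) * B i j) v = qform S B (\<lambda>i. v i * A i s)" for v
          by (simp add: qform_def mult_ac)
        then show ?thesis using psubset.prems(2) by (simp add: psd_def)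
      qed
      ultimately have "psd S (\<lambda>i j. (1 / A s s) * ((A i s * A j s) * B i j) + C i j * B i j)"
        using pos by (intro psd_add psd_scale) auto
      moreover have "(1 / A s s) * ((A i s * A j s) * B i j) + C i j * B i j = A i j * B i j" for i j
        using pos by (simp add: C_def field_simps)
      ultimately show ?thesis by simp
    qed
  qed
qed

lemma qform_deriv:
  assumes "\<And>i j. i \<in> S \<Longrightarrow> j \<in> S \<Longrightarrow> ((\<lambda>t. A t i j) has_real_derivative A' i j) (at t)"
  shows "((\<lambda>t. qform S (A t) v) has_real_derivative qform S A' v) (at t)"
  unfolding qform_def using assms by (intro DERIV_sum DERIV_cmult) auto

text \<open>The FitzGerald-Horn extension principle. The rank-one matrix \<open>B\<close> built from column \<open>s\<close> of
  \<open>A\<close> agrees with \<open>A\<close> in row and column \<open>s\<close>, and \<open>A - B\<close> is positive semidefinite. Along the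
  segment from \<open>B\<close> to \<open>A\<close> the derivative of the quadratic form of \<open>f\<close> is that of the entrywise
  product of \<open>A - B\<close> with \<open>f'\<close> at the current matrix, which lives on \<open>S - {s}\<close>. So positivity for
  \<open>f\<close> on rank-one matrices and for \<open>f'\<close> in one dimension less is enough. Entries are kept strictly
  positive so that \<open>f\<close> may be a power with a small exponent, which is not differentiable at 0.\<close>
lemma entrywise_psd_extension:
  fixes f f' :: "real \<Rightarrow> real" and A :: "'i \<Rightarrow> 'i \<Rightarrow> real"
  assumes fin: "finite S" and s: "s \<in> S"
    and der: "\<And>x. x > 0 \<Longrightarrow> (f has_real_derivative f' x) (at x)"
    and rank1: "\<And>u. (\<And>i. i \<in> S \<Longrightarrow> 0 < u i \<and> (u i)\<^sup>2 \<le> \<rho>) \<Longrightarrow> psd S (\<lambda>i j. f (u i * u j))"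
    and lower: "\<And>B :: 'i \<Rightarrow> 'i \<Rightarrow> real. psd (S - {s}) B \<Longrightarrow>
       (\<And>i j. i \<in> S - {s} \<Longrightarrow> j \<in> S - {s} \<Longrightarrow> B i j \<in> {0<..\<rho>}) \<Longrightarrow> psd (S - {s}) (\<lambda>i j. f' (B i j))"
    and A: "psd S A" "\<And>i j. i \<in> S \<Longrightarrow> j \<in> S \<Longrightarrow> A i j \<in> {0<..\<rho>}"
  shows "psd S (\<lambda>i j. f (A i j))"
proof -
  have sym: "A i j = A j i" if "i \<in> S" "j \<in> S" for i j by (rule psd_sym[OF A(1) that])
  have pos: "A i j > 0" if "i \<in> S" "j \<in> S" for i j using A(2)[OF that] by simp
  note ss = pos[OF s s]
  define u where "u = (\<lambda>i. A i s / sqrt (A s s))"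
  define B where "B = (\<lambda>i j. u i * u j)"
  have B: "B i j = A i s * A j s / A s s" for i j using ss by (simp add: B_def u_def)
  have upos: "u i > 0" if "i \<in> S" for i using pos[OF that s] ss by (simp add: u_def)
  have Bpos: "B i j > 0" if "i \<in> S" "j \<in> S" for i j using upos that by (simp add: B_def)
  have schur: "psd (S - {s}) (\<lambda>i j. A i j - B i j)"
    unfolding B using psd_schur[OF A(1) fin s ss] .
  have ui: "(u i)\<^sup>2 \<le> \<rho>" if "i \<in> S" for i
  proof (cases "i = s")
    case True
    then show ?thesis using A(2)[OF s s] by (simp add: u_def power_divide power2_eq_square)
  next
    case False
    then have "0 \<le> A i i - B i i" using psd_diag[OF schur finite_Diff[OF fin], of i] that by blast
    then show ?thesis using A(2)[OF that that] by (simp add: B_def power2_eq_square)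
  qed
  have Ble: "B i j \<le> \<rho>" if "i \<in> S" "j \<in> S" for i j
  proof -
    have "2 * B i j \<le> (u i)\<^sup>2 + (u j)\<^sup>2" using sum_squares_bound[of "u i" "u j"] by (simp add: B_def)
    then show ?thesis using ui[OF that(1)] ui[OF that(2)] by simp
  qed
  define G where "G = (\<lambda>t i j. B i j + t * (A i j - B i j))"
  have Gr: "G t i j \<in> {0<..\<rho>}" if "0 \<le> t" "t \<le> 1" "i \<in> S" "j \<in> S" for t i j
  proof -
    have eq: "G t i j = (1 - t) * B i j + t * A i j" by (simp add: G_def algebra_simps)
    have "0 < min (A i j) (B i j)" using pos Bpos that by simp
    also have "\<dots> = (1 - t) * min (A i j) (B i j) + t * min (A i j) (B i j)" by (simp add: algebra_simps)
    also have "\<dots> \<le> G t i j" unfolding eq using that by (intro add_mono mult_left_mono) auto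
    finally have "0 < G t i j" .
    moreover have "G t i j \<le> (1 - t) * \<rho> + t * \<rho>"
      unfolding eq using that A(2)[OF that(3,4)] Ble[OF that(3,4)] by (intro add_mono mult_left_mono) auto
    ultimately show ?thesis by (simp add: algebra_simps)
  qed
  have zero: "A s i - B s i = 0" "A i s - B i s = 0" if "i \<in> S" for i
    using ss by (simp_all add: B sym[OF s that])
  have "0 \<le> qform S (\<lambda>i j. f (A i j)) v" for v
  proof -
    define \<phi> where "\<phi> = (\<lambda>t. qform S (\<lambda>i j. f (G t i j)) v)"
    define \<phi>' where "\<phi>' = (\<lambda>t. qform S (\<lambda>i j. (A i j - B i j) * f' (G t i j)) v)"
    have deriv: "(\<phi> has_real_derivative \<phi>' t) (at t)" if "0 \<le> t" "t \<le> 1" for t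
      unfolding \<phi>_def \<phi>'_def
    proof (rule qform_deriv)
      fix i j assume ij: "i \<in> S" "j \<in> S"
      have "((\<lambda>t. G t i j) has_real_derivative (A i j - B i j)) (at t)"
        unfolding G_def by (auto intro!: derivative_eq_intros)
      moreover have "(f has_real_derivative f' (G t i j)) (at (G t i j))"
        using Gr[OF that ij] by (intro der) auto
      ultimately show "((\<lambda>t. f (G t i j)) has_real_derivative (A i j - B i j) * f' (G t i j)) (at t)"
        using DERIV_chain2[of f "f' (G t i j)" "\<lambda>t. G t i j" t "A i j - B i j" UNIV]
        by (simp add: mult.commute)
    qed
    have nonneg: "\<phi>' t \<ge> 0" if "0 \<le> t" "t \<le> 1" for t
    proof -
      have "psd (S - {s}) (\<lambda>i j. (A i j - B i j) * f' (G t i j))"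
      proof (intro psd_hadamard schur lower)
        have "psd S (\<lambda>i j. (1 - t) * B i j + t * A i j)"
          using that A(1) psd_outer[of S u] by (intro psd_add psd_scale) (auto simp: B_def)
        moreover have "(\<lambda>i j. (1 - t) * B i j + t * A i j) = G t"
          by (intro ext) (simp add: G_def algebra_simps)
        ultimately have "psd S (G t)" by simp
        then show "psd (S - {s}) (G t)" using fin by (rule psd_subset) auto
      qed (use fin Gr that in auto)
      then have "psd S (\<lambda>i j. (A i j - B i j) * f' (G t i j))"
        by (subst psd_zero_row[OF fin, of "S - {s}"]) (auto simp only: zero mult_zero_left)
      then show ?thesis unfolding \<phi>'_def by (rule psd_qform)
    qed
    have "\<phi> 0 \<le> \<phi> 1"
      by (rule DERIV_nonneg_imp_nondecreasing[OF zero_le_one]) (use deriv nonneg in blast)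
    moreover have "\<phi> 0 \<ge> 0"
      using psd_qform[OF rank1[of u]] upos ui by (simp add: \<phi>_def G_def B_def)
    ultimately show ?thesis by (simp add: \<phi>_def G_def)
  qed
  moreover have "f (A i j) = f (A j i)" if "i \<in> S" "j \<in> S" for i j
    by (rule arg_cong[OF sym[OF that]])
  ultimately show ?thesis unfolding psd_def by blast
qed

section \<open>Entrywise positivity: rank one and extension to all ranks\<close>

text \<open>The constant whose negative inverse is the threshold for the coefficient of \<open>x powr M\<close>; it
  coincides with the constant of the main theorem, see \<open>vandermonde_ratio\<close>.\<close>
definition rank_one_cost :: "nat set \<Rightarrow> (nat \<Rightarrow> real) \<Rightarrow> (nat \<Rightarrow> real) \<Rightarrow> real \<Rightarrow> real \<Rightarrow> real" where
  "rank_one_cost J e c M \<rho> = (\<Sum>j\<in>J. (lagrange J e j M)\<^sup>2 * \<rho> powr (M - e j) / c j)"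

text \<open>With \<open>P\<close>, \<open>Z\<close>, \<open>Q\<close> the three sums, the sum of \<open>c j * (P * y j - Z * a j / c j)\<^sup>2\<close> equals
  \<open>P * (P * Q - Z\<^sup>2)\<close>.\<close>
lemma weighted_Cauchy_Schwarz:
  fixes a c y :: "'a \<Rightarrow> real"
  assumes "finite J" "\<And>j. j \<in> J \<Longrightarrow> 0 < c j"
  shows "(\<Sum>j\<in>J. a j * y j)\<^sup>2 \<le> (\<Sum>j\<in>J. (a j)\<^sup>2 / c j) * (\<Sum>j\<in>J. c j * (y j)\<^sup>2)"
proof -
  define P where "P = (\<Sum>j\<in>J. (a j)\<^sup>2 / c j)"
  define Z where "Z = (\<Sum>j\<in>J. a j * y j)"
  define Q where "Q = (\<Sum>j\<in>J. c j * (y j)\<^sup>2)"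
  have nn: "0 \<le> (a j)\<^sup>2 / c j" if "j \<in> J" for j using assms(2)[OF that] by simp
  have P0: "P \<ge> 0" unfolding P_def by (intro sum_nonneg nn)
  show ?thesis
  proof (cases "P = 0")
    case True
    then have "\<forall>j\<in>J. (a j)\<^sup>2 / c j = 0"
      unfolding P_def using sum_nonneg_eq_0_iff[OF assms(1) nn] by simp
    moreover have "a j = 0" if "(a j)\<^sup>2 / c j = 0" "j \<in> J" for j
      using that assms(2)[of j] by simp
    ultimately have "Z = 0" unfolding Z_def by (intro sum.neutral) auto
    then show ?thesis using True by (simp add: P_def Z_def)
  next
    case False
    (* The discriminant argument, multiplied out. *)
    have "0 \<le> (\<Sum>j\<in>J. c j * (P * y j - Z * a j / c j)\<^sup>2)"
      using assms(2) by (intro sum_nonneg mult_nonneg_nonneg) (auto simp: less_imp_le)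
    also have "\<dots> = (\<Sum>j\<in>J. P\<^sup>2 * (c j * (y j)\<^sup>2) - 2 * P * Z * (a j * y j) + Z\<^sup>2 * ((a j)\<^sup>2 / c j))"
    proof (rule sum.cong[OF refl])
      fix j assume "j \<in> J"
      then have "c j \<noteq> 0" using assms(2)[of j] by simp
      then show "c j * (P * y j - Z * a j / c j)\<^sup>2
        = P\<^sup>2 * (c j * (y j)\<^sup>2) - 2 * P * Z * (a j * y j) + Z\<^sup>2 * ((a j)\<^sup>2 / c j)"
        by (simp add: power2_eq_square field_simps)
    qed
    also have "\<dots> = P\<^sup>2 * Q - 2 * P * Z * Z + Z\<^sup>2 * P"
      by (simp only: sum.distrib sum_subtractf sum_distrib_left P_def Q_def Z_def)
    also have "\<dots> = P * (P * Q - Z\<^sup>2)" by (simp add: power2_eq_square algebra_simps)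
    finally have "0 \<le> P * Q - Z\<^sup>2" using P0 False by (simp add: zero_le_mult_iff)
    then show ?thesis by (simp add: P_def Q_def Z_def)
  qed
qed

lemma finite_superset_of_card:
  assumes "finite A" "A \<subseteq> B" "infinite B" "card A \<le> n"
  shows "\<exists>X. finite X \<and> card X = n \<and> A \<subseteq> X \<and> X \<subseteq> B"
proof -
  have "infinite (B - A)" using assms by simp
  then obtain T where T: "finite T" "card T = n - card A" "T \<subseteq> B - A"
    using infinite_arbitrarily_large by blast
  have "card (A \<union> T) = card A + card T" using T assms(1) by (intro card_Un_disjoint) auto
  then show ?thesis using T assms by (intro exI[of _ "A \<union> T"]) auto
qed

lemma qform_powr_outer:
  assumes "\<And>i. i \<in> S \<Longrightarrow> 0 < u i"
  shows "qform S (\<lambda>i k. (u i * u k) powr t) v = (\<Sum>i\<in>S. v i * u i powr t)\<^sup>2"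
proof -
  have "qform S (\<lambda>i k. (u i * u k) powr t) v = qform S (\<lambda>i k. u i powr t * u k powr t) v"
    unfolding qform_def using assms by (intro sum.cong refl) (simp add: powr_mult less_imp_le)
  then show ?thesis by (simp add: qform_outer)
qed

text \<open>For a vector \<open>v\<close> put \<open>y j = (\<Sum>i\<in>S. v i * u i powr e j)\<close>. Interpolating \<open>x powr M\<close> at the
  values of \<open>u\<close> writes the corresponding sum for \<open>M\<close> as \<open>\<Sum>j\<in>J. a j * y j\<close>; by the Cauchy-Schwarz
  inequality its square is at most \<open>\<Sum>j\<in>J. (a j)\<^sup>2 / c j\<close> times \<open>\<Sum>j\<in>J. c j * (y j)\<^sup>2\<close>, and the
  bound on the interpolation coefficients compares the first factor with the cost. The entries of
  \<open>u\<close> may repeat: the set of interpolation points is enlarged to the right size.\<close>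
lemma rank_one_psd:
  fixes e c :: "nat \<Rightarrow> real" and u :: "'i \<Rightarrow> real"
  assumes J: "finite J" "inj_on e J" "\<And>j. j \<in> J \<Longrightarrow> e j < M" "\<And>j. j \<in> J \<Longrightarrow> 0 < c j"
    and S: "finite S" "card S = card J" "\<And>i. i \<in> S \<Longrightarrow> 0 < u i \<and> (u i)\<^sup>2 \<le> \<rho>"
    and thr: "0 \<le> 1 + c' * rank_one_cost J e c M \<rho>"
  shows "psd S (\<lambda>i k. (\<Sum>j\<in>J. c j * (u i * u k) powr e j) + c' * (u i * u k) powr M)"
proof (cases "S = {}")
  case True
  then show ?thesis by (simp add: psd_def qform_def)
next
  case False
  then obtain i0 where "i0 \<in> S" by blast
  then have rho: "\<rho> > 0" using S(3)[of i0] by (meson less_le_trans zero_less_power)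
  have uS: "u ` S \<subseteq> {0<..sqrt \<rho>}" using S(3) by (auto simp: real_le_rsqrt)
  have inf: "infinite {0<..sqrt \<rho>}" using rho by (simp add: infinite_Ioc)
  have "card (u ` S) \<le> card J" using card_image_le[OF S(1), of u] S(2) by simp
  then obtain X where X: "finite X" "card X = card J" "u ` S \<subseteq> X" "X \<subseteq> {0<..sqrt \<rho>}"
    using finite_superset_of_card[OF finite_imageI[OF S(1)] uS inf] by blast
  have Xpos: "X \<subseteq> {0<..}" using X(4) by auto
  obtain a where a: "\<forall>x\<in>X. (\<Sum>j\<in>J. a j * x powr e j) = x powr M"
    using powr_interpolation[OF J(1,2) X(1,2) Xpos, of "\<lambda>x. x powr M"] by blast
  have abd: "(a j)\<^sup>2 \<le> (lagrange J e j M)\<^sup>2 * \<rho> powr (M - e j)" if "j \<in> J" for j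
  proof -
    have "\<bar>a j\<bar> \<le> \<bar>lagrange J e j M\<bar> * sqrt \<rho> powr (M - e j)"
      using powr_interpolation_bound[OF J(1-3) X(1,2,4) _ that] a by blast
    then have "(a j)\<^sup>2 \<le> (\<bar>lagrange J e j M\<bar> * sqrt \<rho> powr (M - e j))\<^sup>2"
      by (metis abs_ge_zero power2_abs power_mono)
    also have "\<dots> = (lagrange J e j M)\<^sup>2 * (sqrt \<rho> powr (M - e j))\<^sup>2" by (simp add: power_mult_distrib)
    also have "(sqrt \<rho> powr (M - e j))\<^sup>2 = \<rho> powr (M - e j)"
      using rho by (simp add: power2_eq_square powr_mult[symmetric])
    finally show ?thesis .
  qed
  show ?thesis
  proof (rule psdI)
    fix v
    define y where "y = (\<lambda>j. \<Sum>i\<in>S. v i * u i powr e j)"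
    define z where "z = (\<Sum>i\<in>S. v i * u i powr M)"
    define Q where "Q = (\<Sum>j\<in>J. c j * (y j)\<^sup>2)"
    define C where "C = rank_one_cost J e c M \<rho>"
    have "z = (\<Sum>i\<in>S. v i * (\<Sum>j\<in>J. a j * u i powr e j))"
      unfolding z_def using a X(3) by (intro sum.cong refl) auto
    also have "\<dots> = (\<Sum>i\<in>S. \<Sum>j\<in>J. a j * (v i * u i powr e j))"
      by (simp add: sum_distrib_left mult_ac)
    also have "\<dots> = (\<Sum>j\<in>J. a j * y j)"
      unfolding y_def by (subst sum.swap) (simp add: sum_distrib_left)
    finally have z: "z = (\<Sum>j\<in>J. a j * y j)" .
    have Q0: "Q \<ge> 0" unfolding Q_def using J(4) by (intro sum_nonneg mult_nonneg_nonneg) (auto simp: less_imp_le)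
    have "z\<^sup>2 \<le> (\<Sum>j\<in>J. (a j)\<^sup>2 / c j) * Q"
      unfolding z Q_def using J by (intro weighted_Cauchy_Schwarz) auto
    also have "\<dots> \<le> C * Q"
      unfolding C_def rank_one_cost_def using abd J(4) Q0
      by (intro mult_right_mono sum_mono divide_right_mono) (auto simp: less_imp_le)
    finally have zC: "z\<^sup>2 \<le> C * Q" .
    have q: "qform S (\<lambda>i k. (\<Sum>j\<in>J. c j * (u i * u k) powr e j) + c' * (u i * u k) powr M) v = Q + c' * z\<^sup>2"
      unfolding qform_add qform_sum qform_scale Q_def y_def z_def
      using S(3) by (simp add: qform_powr_outer)
    have "0 \<le> Q + c' * z\<^sup>2"
    proof (cases "c' \<ge> 0")
      case True
      then show ?thesis using Q0 by simp
    next
      case False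
      have "0 \<le> (1 + c' * C) * Q" using thr Q0 by (simp add: C_def)
      also have "\<dots> = Q + c' * (C * Q)" by (simp add: algebra_simps)
      also have "\<dots> \<le> Q + c' * z\<^sup>2" using zC False by (simp add: mult_left_mono_neg)
      finally show ?thesis .
    qed
    then show "0 \<le> qform S (\<lambda>i k. (\<Sum>j\<in>J. c j * (u i * u k) powr e j) + c' * (u i * u k) powr M) v"
      unfolding q .
  qed (simp add: mult.commute)
qed

lemma psd_empty: "psd {} A"
  by (simp add: psd_def qform_def)

lemma exponent_minus_one:
  fixes \<alpha> :: real
  assumes "\<alpha> \<in> \<nat> \<union> {real (Suc n) - 2..}" "\<alpha> \<noteq> 0"
  shows "\<alpha> - 1 \<in> \<nat> \<union> {real n - 2..}"
proof (cases "\<alpha> \<in> \<nat>")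
  case True
  then obtain m where m: "\<alpha> = of_nat m" by (auto elim: Nats_cases)
  then have "\<alpha> - 1 = of_nat (m - 1)" using assms(2) by (cases m) auto
  then show ?thesis by (metis UnI1 of_nat_in_Nats)
next
  case False
  then show ?thesis using assms(1) by auto
qed

text \<open>The FitzGerald-Horn theorem on entrywise powers. Differentiation lowers the exponent and
  the dimension together, so the admissible set of exponents is preserved; an integer exponent
  ends at the constant matrix 1.\<close>
lemma powr_psd:
  fixes A :: "'i \<Rightarrow> 'i \<Rightarrow> real"
  assumes "finite S" "psd S A" "\<And>i j. i \<in> S \<Longrightarrow> j \<in> S \<Longrightarrow> A i j \<in> {0<..\<rho>}"
    and "\<alpha> \<in> \<nat> \<union> {real (card S) - 2..}"
  shows "psd S (\<lambda>i j. A i j powr \<alpha>)"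
  using assms
proof (induction "card S" arbitrary: S A \<alpha>)
  case 0
  then show ?case by (simp add: psd_empty)
next
  case (Suc n)
  show ?case
  proof (cases "\<alpha> = 0")
    case True
    have "psd S (\<lambda>i j. 1 * 1)" by (rule psd_outer)
    moreover have "psd S (\<lambda>i j. 1 * 1) \<longleftrightarrow> psd S (\<lambda>i j. A i j powr \<alpha>)"
      using Suc.prems(3) True by (intro psd_cong) fastforce
    ultimately show ?thesis by simp
  next
    case False
    have "S \<noteq> {}" using Suc.hyps(2) by auto
    then obtain s where s: "s \<in> S" by blast
    have cardS: "card (S - {s}) = n" using Suc.hyps(2) s Suc.prems(1) by simp
    show ?thesis
    proof (rule entrywise_psd_extension[OF Suc.prems(1) s _ _ _ Suc.prems(2,3)])
      show "((\<lambda>x. x powr \<alpha>) has_real_derivative \<alpha> * x powr (\<alpha> - 1)) (at x)" if "x > 0" for x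
        using that by (rule has_real_derivative_powr)
      show "psd S (\<lambda>i j. (u i * u j) powr \<alpha>)" if "\<And>i. i \<in> S \<Longrightarrow> 0 < u i \<and> (u i)\<^sup>2 \<le> \<rho>" for u
        using that by (intro psdI) (auto simp: qform_powr_outer mult.commute)
      fix B :: "'i \<Rightarrow> 'i \<Rightarrow> real"
      assume B: "psd (S - {s}) B" "\<And>i j. i \<in> S - {s} \<Longrightarrow> j \<in> S - {s} \<Longrightarrow> B i j \<in> {0<..\<rho>}"
      show "psd (S - {s}) (\<lambda>i j. \<alpha> * B i j powr (\<alpha> - 1))"
      proof (cases "n = 0")
        case True
        then have "S - {s} = {}" using cardS Suc.prems(1) by simp
        then show ?thesis by (simp only: psd_empty)
      next
        case n: False
        have "\<alpha> \<ge> 0" using Suc.prems(4) Suc.hyps(2) n by (auto simp: Nats_def)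
        moreover have "\<alpha> - 1 \<in> \<nat> \<union> {real (card (S - {s})) - 2..}"
          using exponent_minus_one[OF _ False, of n] Suc.prems(4) Suc.hyps(2) cardS by simp
        then have "psd (S - {s}) (\<lambda>i j. B i j powr (\<alpha> - 1))"
          using Suc.hyps(1)[OF cardS[symmetric] _ B] Suc.prems(1) by blast
        ultimately show ?thesis by (intro psd_scale)
      qed
    qed
  qed
qed

lemma rank_one_cost_nonneg: "(\<And>j. j \<in> J \<Longrightarrow> 0 < c j) \<Longrightarrow> 0 \<le> rank_one_cost J e c M \<rho>"
  unfolding rank_one_cost_def by (intro sum_nonneg divide_nonneg_nonneg mult_nonneg_nonneg) (auto simp: less_imp_le)

text \<open>The threshold for \<open>f\<close> implies the one for \<open>f'\<close> with its smallest exponent dropped.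
  Termwise, removing the node \<open>e j0\<close> and passing to the coefficients \<open>c j * e j\<close> and \<open>M * c'\<close>
  reduces the claim to \<open>M / e j \<le> ((M - e j0) / (e j - e j0))\<^sup>2\<close>.\<close>
lemma rank_one_cost_derivative:
  assumes J: "finite J" "j0 \<in> J" and e0: "0 \<le> e j0"
    and e: "\<And>j. j \<in> J - {j0} \<Longrightarrow> e j0 < e j" "\<And>j. j \<in> J \<Longrightarrow> e j < M" and c: "\<And>j. j \<in> J \<Longrightarrow> 0 < c j"
  shows "M * rank_one_cost (J - {j0}) (\<lambda>j. e j - 1) (\<lambda>j. c j * e j) (M - 1) \<rho> \<le> rank_one_cost J e c M \<rho>"
proof -
  define K where "K = J - {j0}"
  have J': "J = insert j0 K" "finite K" "j0 \<notin> K" using J by (auto simp: K_def)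
  have "M * rank_one_cost K (\<lambda>j. e j - 1) (\<lambda>j. c j * e j) (M - 1) \<rho>
      = (\<Sum>j\<in>K. M * ((lagrange K e j M)\<^sup>2 * \<rho> powr (M - e j) / (c j * e j)))"
    by (simp add: rank_one_cost_def sum_distrib_left lagrange_def)
  also have "\<dots> \<le> (\<Sum>j\<in>K. (lagrange J e j M)\<^sup>2 * \<rho> powr (M - e j) / c j)"
  proof (rule sum_mono)
    fix j assume j: "j \<in> K"
    have ej: "e j0 < e j" "e j < M" "0 < c j" using e c j by (auto simp: K_def)
    have pos: "0 < e j" "0 < M" using ej e0 by auto
    have "J - {j} = insert j0 (K - {j})" using j J' by auto
    then have L: "lagrange J e j M = (M - e j0) / (e j - e j0) * lagrange K e j M"
      using J' by (simp add: lagrange_def)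
    have "0 \<le> (M - e j) * (M * e j - (e j0)\<^sup>2)"
    proof -
      have "e j0 * e j0 \<le> M * e j" using e0 ej by (intro mult_mono) auto
      then show ?thesis using ej by (simp add: power2_eq_square)
    qed
    also have "\<dots> = e j * (M - e j0)\<^sup>2 - M * (e j - e j0)\<^sup>2"
      by (simp add: power2_eq_square algebra_simps)
    finally have "M * (e j - e j0)\<^sup>2 \<le> e j * (M - e j0)\<^sup>2" by simp
    then have key: "M / e j \<le> ((M - e j0) / (e j - e j0))\<^sup>2"
      using pos ej by (simp add: power_divide divide_simps mult.commute)
    have "M * ((lagrange K e j M)\<^sup>2 * \<rho> powr (M - e j) / (c j * e j))
        = M / e j * ((lagrange K e j M)\<^sup>2 * \<rho> powr (M - e j) / c j)"
      by (simp add: mult.commute)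
    also have "\<dots> \<le> ((M - e j0) / (e j - e j0))\<^sup>2 * ((lagrange K e j M)\<^sup>2 * \<rho> powr (M - e j) / c j)"
      using key ej by (intro mult_right_mono) auto
    also have "\<dots> = (lagrange J e j M)\<^sup>2 * \<rho> powr (M - e j) / c j"
      unfolding L power_mult_distrib by simp
    finally show "M * ((lagrange K e j M)\<^sup>2 * \<rho> powr (M - e j) / (c j * e j))
        \<le> (lagrange J e j M)\<^sup>2 * \<rho> powr (M - e j) / c j" .
  qed
  also have "\<dots> \<le> rank_one_cost J e c M \<rho>"
    unfolding rank_one_cost_def using J' c[OF J(2)] by simp
  finally show ?thesis unfolding K_def .
qed

text \<open>By induction on the dimension with the extension principle. The derivative has as many
  powers below \<open>M - 1\<close> as \<open>f\<close> has below \<open>M\<close>, one more than the smaller dimension allows; the one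
  of smallest exponent preserves positivity by itself and is split off.\<close>
lemma entrywise_psd_threshold:
  fixes e c :: "nat \<Rightarrow> real" and A :: "'i \<Rightarrow> 'i \<Rightarrow> real"
  assumes "finite J" "inj_on e J" "\<And>j. j \<in> J \<Longrightarrow> e j < M" "\<And>j. j \<in> J \<Longrightarrow> 0 < c j"
    and "\<And>j. j \<in> J \<Longrightarrow> e j \<in> \<nat> \<union> {real (card J) - 2..}"
    and "finite S" "card S = card J" "psd S A" "\<And>i k. i \<in> S \<Longrightarrow> k \<in> S \<Longrightarrow> A i k \<in> {0<..\<rho>}"
    and "0 \<le> 1 + c' * rank_one_cost J e c M \<rho>"
  shows "psd S (\<lambda>i k. (\<Sum>j\<in>J. c j * A i k powr e j) + c' * A i k powr M)"
  using assms
proof (induction "card J" arbitrary: J S A e c c' M)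
  case 0
  then have "S = {}" by simp
  then show ?case by (simp only: psd_empty)
next
  case (Suc n)
  note J = Suc.prems(1-5) and S = Suc.prems(6-9) and thr = Suc.prems(10)
  have "S \<noteq> {}" using Suc.hyps(2) S(2) by auto
  then obtain s where s: "s \<in> S" by blast
  have cardS: "card (S - {s}) = n" using Suc.hyps(2) s S(1,2) by simp
  show ?case
  proof (rule entrywise_psd_extension[OF S(1) s _ _ _ S(3,4)])
    show "((\<lambda>x. (\<Sum>j\<in>J. c j * x powr e j) + c' * x powr M) has_real_derivative
        ((\<Sum>j\<in>J. c j * (e j * x powr (e j - 1))) + c' * (M * x powr (M - 1)))) (at x)" if "x > 0" for x
      by (intro DERIV_add powr_sum_deriv DERIV_cmult has_real_derivative_powr that)
    show "psd S (\<lambda>i k. (\<Sum>j\<in>J. c j * (u i * u k) powr e j) + c' * (u i * u k) powr M)"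
      if "\<And>i. i \<in> S \<Longrightarrow> 0 < u i \<and> (u i)\<^sup>2 \<le> \<rho>" for u
      by (rule rank_one_psd[OF J(1-4) S(1,2) that thr])
    fix B :: "'i \<Rightarrow> 'i \<Rightarrow> real"
    assume B: "psd (S - {s}) B" "\<And>i j. i \<in> S - {s} \<Longrightarrow> j \<in> S - {s} \<Longrightarrow> B i j \<in> {0<..\<rho>}"
    show "psd (S - {s}) (\<lambda>i k. (\<Sum>j\<in>J. c j * (e j * B i k powr (e j - 1))) + c' * (M * B i k powr (M - 1)))"
    proof (cases "n = 0")
      case True
      then have "S - {s} = {}" using cardS S(1) by simp
      then show ?thesis by (simp only: psd_empty)
    next
      case False
      have "J \<noteq> {}" using Suc.hyps(2) by auto
      then obtain j0 where j0: "j0 \<in> J" "\<And>j. j \<in> J \<Longrightarrow> e j0 \<le> e j"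
        using arg_min_if_finite(1)[OF J(1), of e] arg_min_least[OF J(1), of _ e] by blast
      define K where "K = J - {j0}"
      have J': "J = insert j0 K" "finite K" "j0 \<notin> K" using J(1) j0 by (auto simp: K_def)
      have cardK: "card K = n" using J' Suc.hyps(2) by simp
      have lt: "e j0 < e j" if "j \<in> K" for j
        using j0 J(2) that by (fastforce simp: K_def inj_on_def less_le)
      have e0: "0 \<le> e j0" using J(5)[OF j0(1)] Suc.hyps(2) False by (auto simp: Nats_def)
      have M0: "0 \<le> M" using J(3)[OF j0(1)] e0 by simp
      (* The power of smallest exponent, which preserves positivity by itself. *)
      have first: "psd (S - {s}) (\<lambda>i k. (c j0 * e j0) * B i k powr (e j0 - 1))"
      proof (cases "e j0 = 0")
        case True
        then show ?thesis using psd_outer[of "S - {s}" "\<lambda>_. 0"] by simp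
      next
        case False
        have "e j0 - 1 \<in> \<nat> \<union> {real (card (S - {s})) - 2..}"
          using exponent_minus_one[OF _ False, of n] J(5)[OF j0(1)] Suc.hyps(2) cardS by simp
        then have "psd (S - {s}) (\<lambda>i k. B i k powr (e j0 - 1))"
          using powr_psd[OF _ B] S(1) by blast
        then show ?thesis using e0 J(4)[OF j0(1)] by (intro psd_scale) auto
      qed
      have thr': "0 \<le> 1 + c' * M * rank_one_cost K (\<lambda>j. e j - 1) (\<lambda>j. c j * e j) (M - 1) \<rho>"
      proof (cases "c' \<ge> 0")
        case True
        have "0 \<le> rank_one_cost K (\<lambda>j. e j - 1) (\<lambda>j. c j * e j) (M - 1) \<rho>"
          using lt e0 J(4) by (intro rank_one_cost_nonneg mult_pos_pos) (force simp: K_def)+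
        then show ?thesis using True M0 by simp
      next
        case False
        have "M * rank_one_cost K (\<lambda>j. e j - 1) (\<lambda>j. c j * e j) (M - 1) \<rho> \<le> rank_one_cost J e c M \<rho>"
          unfolding K_def
          by (rule rank_one_cost_derivative[where J = J and e = e, OF J(1) j0(1) e0])
            (use lt J(3,4) in \<open>auto simp: K_def\<close>)
        then have "c' * rank_one_cost J e c M \<rho>
            \<le> c' * (M * rank_one_cost K (\<lambda>j. e j - 1) (\<lambda>j. c j * e j) (M - 1) \<rho>)"
          using False by (intro mult_left_mono_neg) auto
        then show ?thesis using thr by (simp add: mult.assoc)
      qed
      have "psd (S - {s}) (\<lambda>i k. (\<Sum>j\<in>K. (c j * e j) * B i k powr (e j - 1)) + (c' * M) * B i k powr (M - 1))"
      proof (rule Suc.hyps(1)[OF _ _ _ _ _ _ _ _ B])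
        show "inj_on (\<lambda>j. e j - 1) K" using J(2) by (auto simp: inj_on_def K_def)
        fix j assume j: "j \<in> K"
        then have jJ: "j \<in> J" by (simp add: K_def)
        show "0 < c j * e j" using J(4)[OF jJ] lt[OF j] e0 by simp
        have "e j \<noteq> 0" using lt[OF j] e0 by simp
        then show "e j - 1 \<in> \<nat> \<union> {real (card K) - 2..}"
          using exponent_minus_one[of "e j" n] J(5)[OF jJ] Suc.hyps(2) cardK by simp
        show "e j - 1 < M - 1" using J(3)[OF jJ] by simp
      qed (use J' cardK cardS S(1) thr' in auto)
      from psd_add[OF first this] show ?thesis
        using J' by (simp add: mult.assoc add.assoc)
    qed
  qed
qed

lemma continuous_on_rpow: "0 \<le> a \<Longrightarrow> continuous_on {0..} (\<lambda>x. rpow x a)"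
proof (cases "a = 0")
  case True
  then have "rpow x a = 1" for x by (auto simp: rpow_def)
  then show ?thesis by simp
next
  case False
  assume "0 \<le> a"
  then have "continuous_on {0..} (\<lambda>x::real. x powr a)"
    using False by (intro continuous_on_powr' continuous_intros) auto
  then show ?thesis using False by (simp add: rpow_def)
qed

text \<open>Moving \<open>A\<close> towards the constant matrix \<open>\<rho>\<close>, which is positive semidefinite, makes all
  entries positive and keeps them at most \<open>\<rho>\<close>.\<close>
lemma psd_entrywise_closure:
  fixes A :: "'i \<Rightarrow> 'i \<Rightarrow> real"
  assumes cont: "continuous_on {0..\<rho>} f" and rho: "\<rho> > 0"
    and pos: "\<And>B :: 'i \<Rightarrow> 'i \<Rightarrow> real. psd S B \<Longrightarrow> (\<And>i k. i \<in> S \<Longrightarrow> k \<in> S \<Longrightarrow> B i k \<in> {0<..\<rho>})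
       \<Longrightarrow> psd S (\<lambda>i k. f (B i k))"
    and A: "psd S A" "\<And>i k. i \<in> S \<Longrightarrow> k \<in> S \<Longrightarrow> A i k \<in> {0..\<rho>}"
  shows "psd S (\<lambda>i k. f (A i k))"
proof (rule psdI)
  show "f (A i k) = f (A k i)" if "i \<in> S" "k \<in> S" for i k
    by (rule arg_cong[OF psd_sym[OF A(1) that]])
  fix v
  define t where "t = (\<lambda>n. inverse (real (Suc n)))"
  have t: "0 < t n" "t n \<le> 1" for n by (auto simp: t_def divide_simps)
  have tlim: "t \<longlonglongrightarrow> 0" unfolding t_def by (rule LIMSEQ_inverse_real_of_nat)
  (* The second summand is the constant matrix, so that the entries become positive. *)
  define B where "B = (\<lambda>n i k. (1 - t n) * A i k + t n * \<rho>)"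
  have Br: "B n i k \<in> {0<..\<rho>}" if "i \<in> S" "k \<in> S" for n i k
  proof -
    have "(1 - t n) * A i k \<ge> 0" "(1 - t n) * A i k \<le> (1 - t n) * \<rho>"
      using A(2)[OF that] t[of n] by (auto intro!: mult_left_mono)
    moreover have "t n * \<rho> > 0" using t rho by simp
    ultimately show ?thesis by (auto simp: B_def algebra_simps)
  qed
  have "psd S (B n)" for n
  proof -
    have "psd S (\<lambda>i k. (1 - t n) * A i k + (t n * \<rho>) * (1 * 1))"
      using t[of n] rho by (intro psd_add psd_scale A(1) psd_outer) auto
    then show ?thesis by (simp add: B_def)
  qed
  then have "0 \<le> qform S (\<lambda>i k. f (B n i k)) v" for n
    using Br by (intro psd_qform pos)
  moreover have "(\<lambda>n. qform S (\<lambda>i k. f (B n i k)) v) \<longlonglongrightarrow> qform S (\<lambda>i k. f (A i k)) v"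
    unfolding qform_def
  proof (intro tendsto_sum tendsto_mult_left)
    fix i k assume ik: "i \<in> S" "k \<in> S"
    have "(\<lambda>n. B n i k) \<longlonglongrightarrow> (1 - 0) * A i k + 0 * \<rho>"
      unfolding B_def by (intro tendsto_intros tlim)
    then have "(\<lambda>n. B n i k) \<longlonglongrightarrow> A i k" by simp
    then show "(\<lambda>n. f (B n i k)) \<longlonglongrightarrow> f (A i k)"
      using A(2)[OF ik] Br[OF ik]
      by (intro continuous_on_tendsto_compose[OF cont]) (auto simp: less_imp_le)
  qed
  ultimately show "0 \<le> qform S (\<lambda>i k. f (A i k)) v"
    by (intro LIMSEQ_le_const) auto
qed

lemma rpow_pos: "0 < x \<Longrightarrow> rpow x e = x powr e"
  by (simp add: rpow_def)

text \<open>This makes \<open>M\<close> an admissible exponent: otherwise all \<open>n j\<close> would be distinct natural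
  numbers below \<open>N - 2\<close>, and there are \<open>N\<close> of them.\<close>
lemma exponent_lower_bound:
  fixes n :: "nat \<Rightarrow> real"
  assumes N: "N > 0" and less: "\<And>i j. i < j \<Longrightarrow> j < N \<Longrightarrow> n i < n j" and nonneg: "\<And>j. j < N \<Longrightarrow> 0 \<le> n j"
    and range: "\<And>j. j < N \<Longrightarrow> n j \<in> \<nat> \<union> {real N - 2..}"
  shows "real N - 2 \<le> n (N - 1)"
proof (rule ccontr)
  assume neg: "\<not> real N - 2 \<le> n (N - 1)"
  have "n j \<in> \<nat>" if "j < N" for j
  proof -
    have "n j \<le> n (N - 1)" using less[of j "N - 1"] that N by (cases "j = N - 1") (auto simp: less_imp_le)
    then show ?thesis using range[OF that] neg by auto
  qed
  then have "j < N \<Longrightarrow> real j \<le> n j" for j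
  proof (induction j)
    case 0
    then show ?case using nonneg by simp
  next
    case (Suc j)
    obtain k l where k: "n j = real k" "n (Suc j) = real l"
      using Suc.prems(1) Suc.prems(2)[of j] Suc.prems(2)[of "Suc j"] by (auto elim!: Nats_cases)
    have "real j \<le> real k" "real k < real l" using Suc less[of j "Suc j"] k by auto
    then show ?case using k by simp
  qed
  from this[of "N - 1"] show False using neg N by simp
qed

text \<open>Positivity has to be established on all positive semidefinite matrices, because the
  induction on the dimension leaves the class of Hankel matrices.\<close>
lemma entrywise_psd_closed_interval:
  fixes n c :: "nat \<Rightarrow> real"
  assumes f: "f = (\<lambda>x. (\<Sum>j<N. c j * rpow x (n j)) + c' * rpow x M)"
    and N: "N > 0" and less: "\<And>i j. i < j \<Longrightarrow> j < N \<Longrightarrow> n i < n j" and M: "n (N - 1) < M"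
    and nonneg: "\<And>j. j < N \<Longrightarrow> 0 \<le> n j" and range: "\<And>j. j < N \<Longrightarrow> n j \<in> \<nat> \<union> {real N - 2..}"
    and rho: "\<rho> > 0"
    and cond: "((\<forall>j<N. 0 \<le> c j) \<and> 0 \<le> c') \<or> ((\<forall>j<N. 0 < c j) \<and> 0 \<le> 1 + c' * rank_one_cost {..<N} n c M \<rho>)"
    and A: "psd {..<N} A" "\<And>i k. i < N \<Longrightarrow> k < N \<Longrightarrow> A i k \<in> {0..\<rho>}"
  shows "psd {..<N} (\<lambda>i k. f (A i k))"
proof (rule psd_entrywise_closure[OF _ rho _ A(1)])
  have nM: "n j < M" if "j < N" for j
  proof -
    have "j < N - 1 \<or> j = N - 1" using that by linarith
    then show ?thesis using less[of j "N - 1"] M N by auto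
  qed
  have M0: "0 \<le> M" using nM[of 0] nonneg[of 0] N by simp
  have MN: "real N - 2 \<le> M" using exponent_lower_bound[where n = n, OF N less nonneg range] M by simp
  have inj: "inj_on n {..<N}"
    by (rule linorder_inj_onI) (use less in fastforce)+
  have sub: "{0..\<rho>} \<subseteq> {0..}" by auto
  show "continuous_on {0..\<rho>} f"
    unfolding f using nonneg M0
    by (intro continuous_on_add continuous_on_sum continuous_on_mult continuous_on_const
          continuous_on_subset[OF continuous_on_rpow sub]) auto
  fix B :: "nat \<Rightarrow> nat \<Rightarrow> real"
  assume B: "psd {..<N} B" "\<And>i k. i \<in> {..<N} \<Longrightarrow> k \<in> {..<N} \<Longrightarrow> B i k \<in> {0<..\<rho>}"
  have "psd {..<N} (\<lambda>i k. (\<Sum>j<N. c j * B i k powr n j) + c' * B i k powr M)"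
    using cond
  proof
    assume c: "(\<forall>j<N. 0 \<le> c j) \<and> 0 \<le> c'"
    show ?thesis
    proof (intro psd_add psd_sum psd_scale)
      show "psd {..<N} (\<lambda>i k. B i k powr n j)" if "j \<in> {..<N}" for j
        using range[of j] that by (intro powr_psd[OF _ B]) auto
      show "psd {..<N} (\<lambda>i k. B i k powr M)"
        using MN by (intro powr_psd[OF _ B]) auto
    qed (use c in auto)
  next
    assume c: "(\<forall>j<N. 0 < c j) \<and> 0 \<le> 1 + c' * rank_one_cost {..<N} n c M \<rho>"
    show ?thesis
      by (rule entrywise_psd_threshold[OF _ inj _ _ _ _ _ B]) (use c nM range in auto)
  qed
  moreover have "(\<Sum>j<N. c j * B i k powr n j) + c' * B i k powr M = f (B i k)"
    if "i \<in> {..<N}" "k \<in> {..<N}" for i k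
    using B(2)[OF that] by (simp add: f rpow_pos)
  ultimately show "psd {..<N} (\<lambda>i k. f (B i k))"
    using psd_cong[of "{..<N}" "\<lambda>i k. (\<Sum>j<N. c j * B i k powr n j) + c' * B i k powr M" "\<lambda>i k. f (B i k)"] by blast
qed (use A(2) in auto)

section \<open>Determinants and principal minors\<close>

text \<open>Determinants of the leading \<open>k \<times> k\<close> block of an infinite array. Minors are obtained by
  composing the array with index maps, and \<open>insert_index m\<close> is the map that skips \<open>m\<close>.\<close>
definition detn :: "nat \<Rightarrow> (nat \<Rightarrow> nat \<Rightarrow> real) \<Rightarrow> real" where
  "detn k A = det (mat k k (\<lambda>(i, j). A i j))"

lemma detn_cong: "(\<And>i j. i < k \<Longrightarrow> j < k \<Longrightarrow> A i j = B i j) \<Longrightarrow> detn k A = detn k B"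
  unfolding detn_def by (intro arg_cong[of _ _ det] eq_matI) auto

lemma detn_0 [simp]: "detn 0 A = 1"
  by (simp add: detn_def)

lemma detn_transpose: "detn k (\<lambda>i j. A j i) = detn k A"
proof -
  have "detn k (\<lambda>i j. A j i) = det (transpose_mat (mat k k (\<lambda>(i, j). A i j)))"
    unfolding detn_def by (intro arg_cong[of _ _ det] eq_matI) auto
  then show ?thesis unfolding detn_def by (subst (asm) det_transpose) auto
qed

lemma detn_laplace_column:
  assumes "j < Suc k"
  shows "detn (Suc k) A
    = (\<Sum>i<Suc k. (-1) ^ (i + j) * A i j * detn k (\<lambda>a b. A (insert_index i a) (insert_index j b)))"
proof -
  define X where "X = mat (Suc k) (Suc k) (\<lambda>(i, j). A i j)"
  have X: "X \<in> carrier_mat (Suc k) (Suc k)" by (simp add: X_def)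
  have "det X = (\<Sum>i<Suc k. X $$ (i, j) * cofactor X i j)"
    by (rule laplace_expansion_column[OF X assms])
  also have "\<dots> = (\<Sum>i<Suc k. (-1) ^ (i + j) * A i j * detn k (\<lambda>a b. A (insert_index i a) (insert_index j b)))"
  proof (rule sum.cong[OF refl])
    fix i assume i: "i \<in> {..<Suc k}"
    have "mat_delete X i j = mat k k (\<lambda>(a, b). A (insert_index i a) (insert_index j b))"
      by (rule eq_matI) (auto simp: X_def mat_delete_def insert_index_def)
    then have "det (mat_delete X i j) = detn k (\<lambda>a b. A (insert_index i a) (insert_index j b))"
      by (simp add: detn_def)
    then show "X $$ (i, j) * cofactor X i j
        = (-1) ^ (i + j) * A i j * detn k (\<lambda>a b. A (insert_index i a) (insert_index j b))"
      using i assms by (simp add: cofactor_def X_def)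
  qed
  finally show ?thesis by (simp add: detn_def X_def)
qed

lemma detn_laplace_row:
  assumes "i < Suc k"
  shows "detn (Suc k) A
    = (\<Sum>j<Suc k. (-1) ^ (i + j) * A i j * detn k (\<lambda>a b. A (insert_index i a) (insert_index j b)))"
proof -
  have "detn (Suc k) A = detn (Suc k) (\<lambda>a b. A b a)" by (rule detn_transpose[symmetric])
  also have "\<dots> = (\<Sum>j<Suc k. (-1) ^ (j + i) * A i j * detn k (\<lambda>a b. A (insert_index i b) (insert_index j a)))"
    by (rule detn_laplace_column[OF assms])
  also have "\<dots> = (\<Sum>j<Suc k. (-1) ^ (i + j) * A i j * detn k (\<lambda>a b. A (insert_index i a) (insert_index j b)))"
    by (intro sum.cong refl arg_cong2[of _ _ _ _ "(*)"] detn_transpose) (simp add: add.commute)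
  finally show ?thesis .
qed

lemma detn_identical_rows:
  assumes "i < k" "i' < k" "i \<noteq> i'" "\<And>j. j < k \<Longrightarrow> A i j = A i' j"
  shows "detn k A = 0"
  unfolding detn_def using assms
  by (intro det_identical_rows[of _ k i i']) (auto intro!: eq_vecI)

lemma detn_identical_columns:
  assumes "j < k" "j' < k" "j \<noteq> j'" "\<And>i. i < k \<Longrightarrow> A i j = A i j'"
  shows "detn k A = 0"
proof -
  have "detn k (\<lambda>i j. A j i) = 0" using assms by (intro detn_identical_rows[of j k j']) auto
  then show ?thesis by (rule trans[OF detn_transpose[symmetric]])
qed

text \<open>Gaussian elimination of the first column, as a factorization into a unit lower triangular
  matrix and one with first column \<open>(A 0 0, 0, \<dots>, 0)\<close>.\<close>
lemma detn_schur:
  assumes "A 0 0 \<noteq> 0"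
  shows "detn (Suc k) A = A 0 0 * detn k (\<lambda>i j. A (Suc i) (Suc j) - A (Suc i) 0 * A 0 (Suc j) / A 0 0)"
proof -
  define P where "P = (\<lambda>i j :: nat. if j = 0 then A i 0 / A 0 0 else if i = j then 1 else 0)"
  define Q where "Q = (\<lambda>i j. if i = 0 then A 0 j else if j = 0 then 0 else A i j - A i 0 * A 0 j / A 0 0)"
  define X where "X = mat (Suc k) (Suc k) (\<lambda>(i, j). P i j)"
  define Y where "Y = mat (Suc k) (Suc k) (\<lambda>(i, j). Q i j)"
  have "mat (Suc k) (Suc k) (\<lambda>(i, j). A i j) = X * Y"
  proof (rule eq_matI)
    fix i j assume "i < dim_row (X * Y)" "j < dim_col (X * Y)"
    then have ij: "i < Suc k" "j < Suc k" by (auto simp: X_def Y_def)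
    have "(X * Y) $$ (i, j) = (\<Sum>l<Suc k. P i l * Q l j)"
      using ij by (simp add: X_def Y_def scalar_prod_def atLeast0LessThan)
    also have "\<dots> = P i 0 * Q 0 j + (\<Sum>l<k. P i (Suc l) * Q (Suc l) j)"
      by (rule sum.lessThan_Suc_shift)
    also have "(\<Sum>l<k. P i (Suc l) * Q (Suc l) j) = (if i = 0 then 0 else Q i j)"
    proof (cases i)
      case 0
      then show ?thesis by (simp add: P_def)
    next
      case (Suc m)
      then have "(\<Sum>l<k. P i (Suc l) * Q (Suc l) j) = (\<Sum>l<k. if l = m then Q (Suc l) j else 0)"
        by (intro sum.cong) (auto simp: P_def)
      then show ?thesis using Suc ij by simp
    qed
    also have "P i 0 * Q 0 j + (if i = 0 then 0 else Q i j) = A i j"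
      using assms by (auto simp: P_def Q_def)
    finally show "mat (Suc k) (Suc k) (\<lambda>(i, j). A i j) $$ (i, j) = (X * Y) $$ (i, j)" using ij by simp
  qed (auto simp: X_def Y_def)
  then have "detn (Suc k) A = det X * det Y"
    unfolding detn_def by (simp add: det_mult[of _ "Suc k"] X_def Y_def)
  moreover have "det X = 1"
  proof -
    have "det X = prod_list (diag_mat X)"
      by (rule det_lower_triangular[of "Suc k"]) (auto simp: X_def P_def)
    also have "diag_mat X = replicate (Suc k) 1"
      using assms by (intro nth_equalityI) (auto simp: diag_mat_def X_def P_def nth_append simp del: upt_Suc replicate_Suc)
    finally show ?thesis by simp
  qed
  moreover have "det Y = A 0 0 * detn k (\<lambda>i j. A (Suc i) (Suc j) - A (Suc i) 0 * A 0 (Suc j) / A 0 0)"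
  proof -
    have "det Y = detn (Suc k) Q" by (simp add: Y_def detn_def)
    also have "\<dots> = (\<Sum>i<Suc k. (-1) ^ (i + 0) * Q i 0 * detn k (\<lambda>a b. Q (insert_index i a) (insert_index 0 b)))"
      by (rule detn_laplace_column) simp
    also have "\<dots> = A 0 0 * detn k (\<lambda>a b. Q (Suc a) (Suc b))"
      by (subst sum.lessThan_Suc_shift) (simp add: Q_def)
    finally show ?thesis by (simp add: Q_def)
  qed
  ultimately show ?thesis by simp
qed

lemma psd_of_schur:
  assumes "finite S" "s \<in> S" "A s s > 0" "\<And>i j. i \<in> S \<Longrightarrow> j \<in> S \<Longrightarrow> A i j = A j i"
    and "psd (S - {s}) (\<lambda>i j. A i j - A i s * A j s / A s s)"
  shows "psd S A"
proof (rule psdI[OF assms(4)])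
  fix v
  have "A s s \<noteq> 0" using assms(3) by simp
  then have "qform S A v = (\<Sum>i\<in>S. v i * A i s)\<^sup>2 / A s s + qform (S - {s}) (\<lambda>i j. A i j - A i s * A j s / A s s) v"
    by (rule qform_schur[OF assms(1,2)]) (rule assms(4)[OF assms(2)])
  then show "0 \<le> qform S A v" using psd_qform[OF assms(5)] assms(3) by simp
qed

definition increasing_seq :: "nat \<Rightarrow> nat \<Rightarrow> (nat \<Rightarrow> nat) \<Rightarrow> bool" where
  "increasing_seq k n r \<longleftrightarrow> (\<forall>a b. a < b \<longrightarrow> b < k \<longrightarrow> r a < r b) \<and> (\<forall>a<k. r a < n)"

lemma lessThan_Suc_remove0: "{..<Suc N} - {0} = Suc ` {..<N}"
  by (auto simp: lessThan_Suc_eq_insert_0)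

text \<open>The usual argument perturbs the matrix; here a Schur complement is enough, because the
  principal minors of the complement are principal minors of \<open>A\<close> that contain index 0, divided by
  \<open>A 0 0\<close>. If \<open>A 0 0 = 0\<close>, the minors of size two force row 0 to vanish.\<close>
lemma psd_of_principal_minors:
  assumes "\<And>i j. i < N \<Longrightarrow> j < N \<Longrightarrow> A i j = A j i"
    and "\<And>k r. increasing_seq k N r \<Longrightarrow> 0 \<le> detn k (\<lambda>i j. A (r i) (r j))"
  shows "psd {..<N} A"
  using assms
proof (induction N arbitrary: A)
  case 0
  then show ?case by (simp add: psd_empty)
next
  case (Suc N)
  note sym = Suc.prems(1) and minors = Suc.prems(2)
  (* Index 0 is put in front of a shifted sequence. *)
  define shift where "shift = (\<lambda>(r :: nat \<Rightarrow> nat) i. case i of 0 \<Rightarrow> 0 | Suc i \<Rightarrow> Suc (r i))"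
  have shift: "increasing_seq (Suc k) (Suc N) (shift r)" if "increasing_seq k N r" for k r
    using that by (auto simp: increasing_seq_def shift_def split: nat.splits)
  have nonneg: "A 0 0 \<ge> 0"
    using minors[of 1 "\<lambda>_. 0"] by (simp add: increasing_seq_def detn_laplace_row[of 0])
  show ?case
  proof (cases "A 0 0 = 0")
    case True
    have row: "A 0 j = 0" if j: "j < Suc N" for j
    proof (cases "j = 0")
      case False
      have "increasing_seq 2 (Suc N) (\<lambda>i. if i = 0 then 0 else j)"
        using j False by (auto simp: increasing_seq_def)
      from minors[OF this] have "0 \<le> A 0 0 * A j j - A 0 j * A j 0"
        by (simp add: numeral_2_eq_2 detn_laplace_row[of 0] insert_index_def)
      then have "(A 0 j)\<^sup>2 \<le> 0"
        using True sym[OF j, of 0] by (simp add: power2_eq_square)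
      then show ?thesis by simp
    qed (use True in simp)
    have "psd {..<N} (\<lambda>i j. A (Suc i) (Suc j))"
    proof (rule Suc.IH)
      fix k r assume "increasing_seq k N r"
      then have "increasing_seq k (Suc N) (\<lambda>i. Suc (r i))" by (auto simp: increasing_seq_def)
      from minors[OF this] show "0 \<le> detn k (\<lambda>i j. A (Suc (r i)) (Suc (r j)))" .
    qed (auto intro: sym)
    then have "psd ({..<Suc N} - {0}) A"
      unfolding lessThan_Suc_remove0 by (subst psd_reindex) auto
    moreover have "psd {..<Suc N} A \<longleftrightarrow> psd ({..<Suc N} - {0}) A"
    proof (rule psd_zero_row)
      fix i j assume "i \<in> {..<Suc N} - ({..<Suc N} - {0})" "j \<in> {..<Suc N}"
      then have "i = 0" "j < Suc N" by auto
      then show "A i j = 0 \<and> A j i = 0" using row[of j] sym[of 0 j] by simp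
    qed auto
    ultimately show ?thesis by blast
  next
    case False
    define B where "B = (\<lambda>i j. A i j - A i 0 * A j 0 / A 0 0)"
    have "psd {..<N} (\<lambda>i j. B (Suc i) (Suc j))"
    proof (rule Suc.IH)
      fix i j assume "i < N" "j < N"
      then show "B (Suc i) (Suc j) = B (Suc j) (Suc i)"
        using sym[of "Suc i" "Suc j"] by (simp add: B_def)
    next
      fix k r assume r: "increasing_seq k N r"
      have "0 \<le> detn (Suc k) (\<lambda>i j. A (shift r i) (shift r j))" by (rule minors[OF shift[OF r]])
      also have "\<dots> = A 0 0 * detn k (\<lambda>i j. A (Suc (r i)) (Suc (r j)) - A (Suc (r i)) 0 * A 0 (Suc (r j)) / A 0 0)"
        using False by (subst detn_schur) (auto simp: shift_def)
      also have "detn k (\<lambda>i j. A (Suc (r i)) (Suc (r j)) - A (Suc (r i)) 0 * A 0 (Suc (r j)) / A 0 0)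
          = detn k (\<lambda>i j. B (Suc (r i)) (Suc (r j)))"
      proof (rule detn_cong)
        fix i j assume "j < k"
        then have "A 0 (Suc (r j)) = A (Suc (r j)) 0"
          using r by (intro sym) (auto simp: increasing_seq_def)
        then show "A (Suc (r i)) (Suc (r j)) - A (Suc (r i)) 0 * A 0 (Suc (r j)) / A 0 0 = B (Suc (r i)) (Suc (r j))"
          by (simp add: B_def)
      qed
      finally show "0 \<le> detn k (\<lambda>i j. B (Suc (r i)) (Suc (r j)))"
        using nonneg False by (simp add: zero_le_mult_iff)
    qed
    then have "psd ({..<Suc N} - {0}) B"
      unfolding lessThan_Suc_remove0 by (subst psd_reindex) auto
    then show ?thesis
      unfolding B_def by (rule psd_of_schur[of _ 0, rotated 4]) (use nonneg False sym in auto)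
  qed
qed

definition pd :: "'i set \<Rightarrow> ('i \<Rightarrow> 'i \<Rightarrow> real) \<Rightarrow> bool" where
  "pd S A \<longleftrightarrow> (\<forall>i\<in>S. \<forall>j\<in>S. A i j = A j i) \<and> (\<forall>v. (\<exists>i\<in>S. v i \<noteq> 0) \<longrightarrow> 0 < qform S A v)"

lemma pd_sym: "pd S A \<Longrightarrow> i \<in> S \<Longrightarrow> j \<in> S \<Longrightarrow> A i j = A j i"
  unfolding pd_def by blast

lemma pd_qform: "pd S A \<Longrightarrow> i \<in> S \<Longrightarrow> v i \<noteq> 0 \<Longrightarrow> 0 < qform S A v"
  unfolding pd_def by blast

lemma pdI:
  "(\<And>i j. i \<in> S \<Longrightarrow> j \<in> S \<Longrightarrow> A i j = A j i) \<Longrightarrow> (\<And>v i. i \<in> S \<Longrightarrow> v i \<noteq> 0 \<Longrightarrow> 0 < qform S A v) \<Longrightarrow> pd S A"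
  unfolding pd_def by blast

lemma pd_reindex:
  fixes A :: "'i \<Rightarrow> 'i \<Rightarrow> real" and h :: "'j \<Rightarrow> 'i"
  assumes "pd S A" "finite S" "inj_on h T" "h ` T \<subseteq> S"
  shows "pd T (\<lambda>i j. A (h i) (h j))"
proof (rule pdI)
  show "A (h i) (h j) = A (h j) (h i)" if "i \<in> T" "j \<in> T" for i j
    using assms(4) that by (intro pd_sym[OF assms(1)]) auto
  fix v :: "'j \<Rightarrow> real" and i assume i: "i \<in> T" "v i \<noteq> 0"
  define w where "w = (\<lambda>x. if x \<in> h ` T then v (inv_into T h x) else 0)"
  have wh: "w (h j) = v j" if "j \<in> T" for j using that assms(3) by (simp add: w_def)
  have "0 < qform S A w" using i assms(4) wh by (intro pd_qform[OF assms(1), of "h i"]) auto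
  also have "qform S A w = (\<Sum>x\<in>h ` T. \<Sum>y\<in>S. w x * w y * A x y)"
    unfolding qform_def using assms by (intro sum.mono_neutral_right) (auto simp: w_def)
  also have "\<dots> = (\<Sum>x\<in>h ` T. \<Sum>y\<in>h ` T. w x * w y * A x y)"
    using assms by (intro sum.cong refl sum.mono_neutral_right) (auto simp: w_def)
  also have "\<dots> = qform T (\<lambda>i j. A (h i) (h j)) v"
    unfolding qform_def using assms(3) wh by (simp add: sum.reindex)
  finally show "0 < qform T (\<lambda>i j. A (h i) (h j)) v" .
qed

lemma pd_schur:
  fixes A :: "'i \<Rightarrow> 'i \<Rightarrow> real"
  assumes "pd S A" "finite S" "s \<in> S"
  shows "A s s > 0" "pd (S - {s}) (\<lambda>i j. A i j - A i s * A j s / A s s)"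
proof -
  have "0 < qform S A (\<lambda>i. if i = s then 1 else 0)"
    using assms(3) by (intro pd_qform[OF assms(1), of s]) auto
  also have "\<dots> = A s s"
    using assms(2,3) by (simp add: qform_def if_distrib[of "\<lambda>x. x * _"] if_distrib[of "\<lambda>x. _ * x"] cong: if_cong)
  finally show pos: "A s s > 0" .
  define B where "B = (\<lambda>i j. A i j - A i s * A j s / A s s)"
  show "pd (S - {s}) (\<lambda>i j. A i j - A i s * A j s / A s s)"
    unfolding B_def[symmetric]
  proof (rule pdI)
    show "B i j = B j i" if "i \<in> S - {s}" "j \<in> S - {s}" for i j
      using pd_sym[OF assms(1), of i j] that by (simp add: B_def)
    fix v :: "'i \<Rightarrow> real" and i assume i: "i \<in> S - {s}" "v i \<noteq> 0"
    (* The value at s that annihilates the completed square. *)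
    define t where "t = - (\<Sum>i\<in>S-{s}. v i * A i s) / A s s"
    have "(\<Sum>i\<in>S. (v(s := t)) i * A i s) = t * A s s + (\<Sum>i\<in>S-{s}. v i * A i s)"
      using assms(2,3) by (subst sum.remove[of _ s]) (auto intro!: sum.cong)
    also have "\<dots> = 0" using pos by (simp add: t_def)
    finally have 0: "(\<Sum>i\<in>S. (v(s := t)) i * A i s) = 0" .
    have "qform S A (v(s := t)) = qform (S - {s}) B (v(s := t))"
      using qform_schur[where A = A and v = "v(s := t)", OF assms(2,3) less_imp_neq[OF pos, symmetric]
          pd_sym[OF assms(1,3)]] unfolding 0 B_def by simp
    also have "\<dots> = qform (S - {s}) B v" unfolding qform_def by (intro sum.cong refl) auto
    finally show "0 < qform (S - {s}) B v"
      using pd_qform[OF assms(1), of i "v(s := t)"] i by simp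
  qed
qed

text \<open>Elimination of the first column leaves a Schur complement, which is again positive
  definite.\<close>
lemma pd_detn_pos: "pd {..<k} A \<Longrightarrow> 0 < detn k A"
proof (induction k arbitrary: A)
  case 0
  then show ?case by simp
next
  case (Suc k)
  note schur = pd_schur[OF Suc.prems finite_lessThan, of 0]
  have pos: "A 0 0 > 0" using schur(1) by simp
  have "pd {..<k} (\<lambda>i j. A (Suc i) (Suc j) - A (Suc i) 0 * A (Suc j) 0 / A 0 0)"
    using schur(2) by (intro pd_reindex[where h = Suc and S = "{..<Suc k} - {0}"]) auto
  then have "0 < detn k (\<lambda>i j. A (Suc i) (Suc j) - A (Suc i) 0 * A (Suc j) 0 / A 0 0)" by (rule Suc.IH)
  also have "\<dots> = detn k (\<lambda>i j. A (Suc i) (Suc j) - A (Suc i) 0 * A 0 (Suc j) / A 0 0)"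
  proof (rule detn_cong)
    fix i j assume "j < k"
    then have "A 0 (Suc j) = A (Suc j) 0" by (intro pd_sym[OF Suc.prems]) auto
    then show "A (Suc i) (Suc j) - A (Suc i) 0 * A (Suc j) 0 / A 0 0
        = A (Suc i) (Suc j) - A (Suc i) 0 * A 0 (Suc j) / A 0 0" by simp
  qed
  finally show ?case using pos by (subst detn_schur) auto
qed

section \<open>Fekete's criterion and Hankel matrices\<close>

text \<open>The maximal minors of a matrix with \<open>l + 1\<close> rows and \<open>l + 2\<close> columns, with alternating
  signs, form a linear relation among its columns: repeating row \<open>a\<close> gives a singular square
  matrix, and this is its expansion along the repeated row.\<close>
lemma alternating_minors_annihilate_rows:
  fixes A :: "nat \<Rightarrow> nat \<Rightarrow> real"
  assumes "a < Suc l"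
  shows "(\<Sum>b<Suc (Suc l). (-1) ^ b * detn (Suc l) (\<lambda>r c. A r (insert_index b c)) * A a b) = 0"
proof -
  define X where "X = (\<lambda>r b. if r < Suc l then A r b else A a b)"
  have "detn (Suc (Suc l)) X = 0"
    using assms by (intro detn_identical_rows[of a _ "Suc l"]) (auto simp: X_def)
  then have "0 = (-1) ^ Suc l * detn (Suc (Suc l)) X" by simp
  also have "\<dots> = (\<Sum>b<Suc (Suc l). (-1) ^ Suc l * ((-1) ^ (Suc l + b) * X (Suc l) b
      * detn (Suc l) (\<lambda>r c. X (insert_index (Suc l) r) (insert_index b c))))"
    by (subst detn_laplace_row[of "Suc l"]) (simp_all only: sum_distrib_left lessI)
  also have "\<dots> = (\<Sum>b<Suc (Suc l). (-1) ^ b * detn (Suc l) (\<lambda>r c. A r (insert_index b c)) * A a b)"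
  proof (rule sum.cong[OF refl])
    fix b
    have "detn (Suc l) (\<lambda>r c. X (insert_index (Suc l) r) (insert_index b c))
        = detn (Suc l) (\<lambda>r c. A r (insert_index b c))"
      by (rule detn_cong) (simp add: X_def)
    moreover have "X (Suc l) b = A a b" by (simp add: X_def)
    moreover have "(-1::real) ^ Suc l * (-1) ^ (Suc l + b) = (-1) ^ b"
      by (simp add: power_add[symmetric] flip: mult.assoc) (simp add: power_add power_mult_distrib[symmetric])
    ultimately show "(-1) ^ Suc l * ((-1) ^ (Suc l + b) * X (Suc l) b
      * detn (Suc l) (\<lambda>r c. X (insert_index (Suc l) r) (insert_index b c)))
      = (-1) ^ b * detn (Suc l) (\<lambda>r c. A r (insert_index b c)) * A a b"
      by (simp only: mult.assoc[symmetric]) (simp only: ac_simps)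
  qed
  finally show ?thesis by simp
qed

text \<open>A Pluecker relation that mixes minors of size \<open>l + 1\<close> with minors of size \<open>l\<close> on the first
  \<open>l\<close> rows. A linear functional \<open>F\<close> that kills all columns except \<open>0\<close>, \<open>m\<close> and \<open>l + 1\<close>, namely the
  determinant with the other columns filled in, is applied to the linear relation among all
  columns.\<close>
lemma three_term_minor_identity:
  fixes A :: "nat \<Rightarrow> nat \<Rightarrow> real"
  assumes m: "0 < m" "m \<le> l"
  shows "detn (Suc l) (\<lambda>a b. A a (insert_index m b)) * detn l (\<lambda>a b. A a (Suc b))
    = detn (Suc l) (\<lambda>a b. A a (insert_index (Suc l) b)) * detn l (\<lambda>a b. A a (insert_index m (Suc b)))
    + detn (Suc l) (\<lambda>a b. A a (insert_index 0 b)) * detn l (\<lambda>a b. A a (insert_index m b))"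
proof -
  obtain q where l: "l = Suc q" using m by (cases l) auto
  define T where "T = (\<lambda>b. insert_index m (Suc b))"
  define F where "F = (\<lambda>x. \<Sum>i<l. (-1) ^ i * A i x * detn q (\<lambda>a b. A (insert_index i a) (T b)))"
  define d where "d = (\<lambda>b. detn (Suc l) (\<lambda>r c. A r (insert_index b c)))"
  (* Inserting a column at position p is the functional F up to the sign of moving it to the front. *)
  have ins: "detn l (\<lambda>a b. A a (\<delta> b)) = (-1) ^ p * F (\<delta> p)"
    if "p < l" "\<And>b. b < q \<Longrightarrow> \<delta> (insert_index p b) = T b" for \<delta> p
  proof -
    have "detn l (\<lambda>a b. A a (\<delta> b))
        = (\<Sum>i<l. (-1) ^ (i + p) * A i (\<delta> p) * detn q (\<lambda>a b. A (insert_index i a) (\<delta> (insert_index p b))))"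
      unfolding l using that(1) by (intro detn_laplace_column) (simp add: l)
    also have "\<dots> = (\<Sum>i<l. (-1) ^ p * ((-1) ^ i * A i (\<delta> p) * detn q (\<lambda>a b. A (insert_index i a) (T b))))"
    proof (rule sum.cong[OF refl])
      fix i
      have "detn q (\<lambda>a b. A (insert_index i a) (\<delta> (insert_index p b))) = detn q (\<lambda>a b. A (insert_index i a) (T b))"
        using that(2) by (intro detn_cong) simp
      then show "(-1) ^ (i + p) * A i (\<delta> p) * detn q (\<lambda>a b. A (insert_index i a) (\<delta> (insert_index p b)))
        = (-1) ^ p * ((-1) ^ i * A i (\<delta> p) * detn q (\<lambda>a b. A (insert_index i a) (T b)))"
        by (simp add: power_add)
    qed
    finally show ?thesis by (simp add: F_def sum_distrib_left)
  qed
  have FT: "F (T c) = 0" if "c < q" for c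
  proof -
    (* The column T c now occurs twice. *)
    define \<delta> where "\<delta> = (\<lambda>b. case b of 0 \<Rightarrow> T c | Suc b \<Rightarrow> T b)"
    have "detn l (\<lambda>a b. A a (\<delta> b)) = (-1) ^ 0 * F (\<delta> 0)"
      by (rule ins) (auto simp: l \<delta>_def)
    moreover have "detn l (\<lambda>a b. A a (\<delta> b)) = 0"
      using that by (intro detn_identical_columns[of 0 _ "Suc c"]) (auto simp: l \<delta>_def)
    ultimately show ?thesis by (simp add: \<delta>_def)
  qed
  have zero: "F b = 0" if "b < Suc (Suc l)" "b \<noteq> 0" "b \<noteq> m" "b \<noteq> Suc l" for b
  proof (cases "b < m")
    case True
    then have "b = T (b - 1)" "b - 1 < q" using that m l by (auto simp: T_def)
    then show ?thesis using FT by metis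
  next
    case False
    then have "b = T (b - 2)" "b - 2 < q" using that m l by (auto simp: T_def)
    then show ?thesis using FT by metis
  qed
  have "(\<Sum>b<Suc (Suc l). (-1) ^ b * d b * F b)
      = (\<Sum>b<Suc (Suc l). \<Sum>i<l. ((-1) ^ i * detn q (\<lambda>a b. A (insert_index i a) (T b))) * ((-1) ^ b * d b * A i b))"
    unfolding F_def sum_distrib_left by (intro sum.cong refl) (simp only: ac_simps)
  also have "\<dots> = (\<Sum>i<l. ((-1) ^ i * detn q (\<lambda>a b. A (insert_index i a) (T b)))
        * (\<Sum>b<Suc (Suc l). (-1) ^ b * d b * A i b))"
    unfolding sum_distrib_left by (rule sum.swap)
  also have "\<dots> = 0"
  proof (rule sum.neutral, rule ballI)
    fix i assume "i \<in> {..<l}"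
    then have "(\<Sum>b<Suc (Suc l). (-1) ^ b * d b * A i b) = 0"
      unfolding d_def by (intro alternating_minors_annihilate_rows) simp
    then show "((-1) ^ i * detn q (\<lambda>a b. A (insert_index i a) (T b)))
        * (\<Sum>b<Suc (Suc l). (-1) ^ b * d b * A i b) = 0" by simp
  qed
  finally have "0 = (\<Sum>b<Suc (Suc l). (-1) ^ b * d b * F b)" by simp
  also have "\<dots> = (\<Sum>b\<in>{0, m, Suc l}. (-1) ^ b * d b * F b)"
    using m zero by (intro sum.mono_neutral_right) auto
  also have "\<dots> = d 0 * F 0 + (-1) ^ m * d m * F m + (-1) ^ Suc l * d (Suc l) * F (Suc l)"
    using m by simp
  finally have rel: "0 = d 0 * F 0 + (-1) ^ m * d m * F m + (-1) ^ Suc l * d (Suc l) * F (Suc l)" .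
  have F0: "detn l (\<lambda>a b. A a (insert_index m b)) = F 0"
    using ins[of 0 "insert_index m"] m by (simp add: l T_def)
  have Fm: "detn l (\<lambda>a b. A a (Suc b)) = (-1) ^ (m - 1) * F m"
  proof -
    have "detn l (\<lambda>a b. A a (Suc b)) = (-1) ^ (m - 1) * F (Suc (m - 1))"
      by (rule ins) (use m in \<open>auto simp: T_def insert_index_def\<close>)
    then show ?thesis using m by simp
  qed
  have Fl: "detn l (\<lambda>a b. A a (insert_index m (Suc b))) = (-1) ^ q * F (Suc l)"
    using ins[of q "\<lambda>b. insert_index m (Suc b)"] m by (simp add: l T_def)
  have s1: "(-1::real) ^ m = - ((-1) ^ (m - 1))" using m by (cases m) auto
  have s2: "(-1::real) ^ Suc l = (-1) ^ q" by (simp add: l)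
  have "d m * ((-1) ^ (m - 1) * F m) = d 0 * F 0 + d (Suc l) * ((-1) ^ q * F (Suc l))"
  proof -
    have "b * (u * y) = x + c * (w * z)" if "0 = x + - u * b * y + w * c * z" for b c u w x y z :: real
    proof -
      have "- u * b * y = - (b * (u * y))" "w * c * z = c * (w * z)" by simp_all
      then show ?thesis using that by linarith
    qed
    from this[OF rel[unfolded s1 s2]] show ?thesis .
  qed
  then show ?thesis unfolding F0 Fm Fl by (simp add: d_def)
qed

lemma increasing_seq_less: "increasing_seq k n r \<Longrightarrow> a < b \<Longrightarrow> b < k \<Longrightarrow> r a < r b"
  by (simp add: increasing_seq_def)

lemma increasing_seq_bound: "increasing_seq k n r \<Longrightarrow> a < k \<Longrightarrow> r a < n"
  by (simp add: increasing_seq_def)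

lemma increasing_seq_inj_on:
  assumes "increasing_seq k n r"
  shows "inj_on r {..<k}"
proof (rule inj_onI, rule ccontr)
  fix x y assume xy: "x \<in> {..<k}" "y \<in> {..<k}" "r x = r y" "x \<noteq> y"
  then have "x < y \<or> y < x" by auto
  then show False
    using xy increasing_seq_less[OF assms, of x y] increasing_seq_less[OF assms, of y x] by auto
qed

lemma increasing_seq_compose:
  "increasing_seq k n r \<Longrightarrow> increasing_seq l k h \<Longrightarrow> increasing_seq l n (\<lambda>i. r (h i))"
  by (auto simp: increasing_seq_def)

lemma increasing_seq_insert_index: "increasing_seq l (Suc l) (insert_index m)"
  by (auto simp: increasing_seq_def insert_index_def)

lemma increasing_seq_mono: "increasing_seq k n r \<Longrightarrow> l \<le> k \<Longrightarrow> increasing_seq l n r"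
  by (auto simp: increasing_seq_def)

text \<open>Induction on the spread \<open>\<gamma> l - \<gamma> 0\<close> of the column set. A column placed in a gap gives
  \<open>l + 2\<close> columns, and in the three-term identity every minor other than the wanted one is of
  smaller size or has smaller spread.\<close>
lemma minors_pos_of_contiguous_columns:
  assumes low: "\<And>\<gamma>. increasing_seq (k - 1) n \<gamma> \<Longrightarrow> 0 < detn (k - 1) (\<lambda>a b. B a (\<gamma> b))"
    and contig: "\<And>j. j + k \<le> n \<Longrightarrow> 0 < detn k (\<lambda>a b. B a (j + b))"
    and \<gamma>: "increasing_seq k n \<gamma>"
  shows "0 < detn k (\<lambda>a b. B a (\<gamma> b))"
proof (cases k)
  case 0
  then show ?thesis by simp
next
  case (Suc l)
  show ?thesis using \<gamma>
  proof (induction "\<gamma> l - \<gamma> 0" arbitrary: \<gamma> rule: less_induct)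
    case less
    note \<gamma> = less.prems[unfolded Suc]
    show ?case
    proof (cases "\<exists>m. 0 < m \<and> m \<le> l \<and> Suc (\<gamma> (m - 1)) < \<gamma> m")
      case False
      have eq: "i \<le> l \<Longrightarrow> \<gamma> i = \<gamma> 0 + i" for i
      proof (induction i)
        case (Suc i)
        have "\<gamma> i < \<gamma> (Suc i)" using increasing_seq_less[OF \<gamma>] Suc.prems by simp
        moreover have "\<not> Suc (\<gamma> i) < \<gamma> (Suc i)" using False Suc.prems by auto
        ultimately show ?case using Suc by simp
      qed simp
      have "\<gamma> l < n" using increasing_seq_bound[OF \<gamma>] by simp
      then have "0 < detn k (\<lambda>a b. B a (\<gamma> 0 + b))"
        using eq[of l] Suc by (intro contig) simp
      also have "\<dots> = detn k (\<lambda>a b. B a (\<gamma> b))"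
      proof (rule detn_cong)
        fix i j assume "j < k"
        then have "\<gamma> j = \<gamma> 0 + j" using Suc by (intro eq) simp
        then show "B i (\<gamma> 0 + j) = B i (\<gamma> j)" by simp
      qed
      finally show ?thesis .
    next
      case True
      then obtain m where m: "0 < m" "m \<le> l" "Suc (\<gamma> (m - 1)) < \<gamma> m" by blast
      (* The columns together with a new one in the gap before column m. *)
      define \<beta> where "\<beta> = (\<lambda>i. if i < m then \<gamma> i else if i = m then Suc (\<gamma> (m - 1)) else \<gamma> (i - 1))"
      have \<beta>: "increasing_seq (Suc (Suc l)) n \<beta>"
      proof -
        have step: "\<beta> i < \<beta> (Suc i)" if "Suc i < Suc (Suc l)" for i
        proof -
          consider "Suc i < m" | "Suc i = m" | "i = m" | "m < i" by linarith
          then show ?thesis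
          proof cases
            case 1
            then show ?thesis using increasing_seq_less[OF \<gamma>, of i "Suc i"] m that by (simp add: \<beta>_def)
          next
            case 2
            then show ?thesis using m by (auto simp: \<beta>_def)
          next
            case 3
            then show ?thesis using m by (simp add: \<beta>_def)
          next
            case 4
            then show ?thesis using increasing_seq_less[OF \<gamma>, of "i - 1" i] that by (simp add: \<beta>_def)
          qed
        qed
        have less: "\<beta> a < \<beta> b" if "a < b" "b < Suc (Suc l)" for a b
          using that
        proof (induction b)
          case (Suc b)
          have "\<beta> b < \<beta> (Suc b)" using step Suc.prems by simp
          moreover have "a = b \<or> \<beta> a < \<beta> b" using Suc by (cases "a = b") auto
          ultimately show ?case by auto
        qed simp
        moreover have "\<beta> a < n" if "a < Suc (Suc l)" for a
        proof -
          have "\<beta> (Suc l) = \<gamma> l" using m by (simp add: \<beta>_def)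
          then have "\<beta> (Suc l) < n" using increasing_seq_bound[OF \<gamma>, of l] by simp
          then show ?thesis using less[of a "Suc l"] that by (cases "a = Suc l") auto
        qed
        ultimately show ?thesis by (simp add: increasing_seq_def)
      qed
      have \<beta>m: "\<beta> (insert_index m b) = \<gamma> b" for b
        by (cases "b < m") (auto simp: \<beta>_def)
      have \<beta>0: "\<beta> 0 = \<gamma> 0" and \<beta>l: "\<beta> (Suc l) = \<gamma> l" using m by (auto simp: \<beta>_def)
      have IH: "0 < detn (Suc l) (\<lambda>a b. B a (\<beta> (insert_index i b)))"
        if "\<beta> (insert_index i l) - \<beta> (insert_index i 0) < \<gamma> l - \<gamma> 0" for i
        using less.hyps[OF that] increasing_seq_compose[OF \<beta> increasing_seq_insert_index] Suc by simp
      have low': "0 < detn l (\<lambda>a b. B a (\<beta> (h b)))" if "increasing_seq l (Suc (Suc l)) h" for h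
        using low[of "\<lambda>b. \<beta> (h b)"] increasing_seq_compose[OF \<beta> that] Suc by simp
      have "\<beta> 0 < \<beta> l" "\<beta> l < \<beta> (Suc l)" "\<beta> 0 < \<beta> 1" "\<beta> 1 \<le> \<beta> (Suc l)"
        using increasing_seq_less[OF \<beta>] m by (auto simp: le_less)
      then have "\<beta> l - \<beta> 0 < \<gamma> l - \<gamma> 0" "\<beta> (Suc l) - \<beta> (Suc 0) < \<gamma> l - \<gamma> 0"
        unfolding \<beta>0 \<beta>l by simp_all
      then have d: "0 < detn (Suc l) (\<lambda>a b. B a (\<beta> (insert_index (Suc l) b)))"
          "0 < detn (Suc l) (\<lambda>a b. B a (\<beta> (insert_index 0 b)))"
        using IH[of "Suc l"] IH[of 0] by simp_all
      have "increasing_seq l (Suc (Suc l)) (\<lambda>b. insert_index m b)"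
        "increasing_seq l (Suc (Suc l)) (\<lambda>b. insert_index m (Suc b))" "increasing_seq l (Suc (Suc l)) Suc"
        by (auto simp: increasing_seq_def insert_index_def)
      note low' = this[THEN low']
      have "detn (Suc l) (\<lambda>a b. B a (\<gamma> b)) * detn l (\<lambda>a b. B a (\<beta> (Suc b)))
        = detn (Suc l) (\<lambda>a b. B a (\<beta> (insert_index (Suc l) b))) * detn l (\<lambda>a b. B a (\<beta> (insert_index m (Suc b))))
        + detn (Suc l) (\<lambda>a b. B a (\<beta> (insert_index 0 b))) * detn l (\<lambda>a b. B a (\<beta> (insert_index m b)))"
        using three_term_minor_identity[OF m(1,2), of "\<lambda>a b. B a (\<beta> b)"] unfolding \<beta>m .
      also have "\<dots> > 0" using d low' by (intro add_pos_pos mult_pos_pos)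
      finally show ?thesis using low'(3) Suc by (simp add: zero_less_mult_iff)
    qed
  qed
qed

text \<open>Fekete's criterion: the columns are freed first, then the rows.\<close>
lemma minors_pos_of_contiguous:
  assumes contig: "\<And>k i j. i + k \<le> m \<Longrightarrow> j + k \<le> n \<Longrightarrow> 0 < detn k (\<lambda>a b. A (i + a) (j + b))"
  shows "increasing_seq k m r \<Longrightarrow> increasing_seq k n c \<Longrightarrow> 0 < detn k (\<lambda>a b. A (r a) (c b))"
proof (induction k arbitrary: r c)
  case 0
  then show ?case by simp
next
  case (Suc l)
  have step: "0 < detn (Suc l) (\<lambda>a b. A (i + a) (\<gamma> b))"
    if "i + Suc l \<le> m" "increasing_seq (Suc l) n \<gamma>" for i \<gamma>
  proof (rule minors_pos_of_contiguous_columns[OF _ _ that(2), of "\<lambda>a b. A (i + a) b"])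
    fix \<delta> assume "increasing_seq (Suc l - 1) n \<delta>"
    then have "0 < detn l (\<lambda>a b. A (i + a) (\<delta> b))"
      using that(1) by (intro Suc.IH) (auto simp: increasing_seq_def)
    then show "0 < detn (Suc l - 1) (\<lambda>a b. A (i + a) (\<delta> b))" by simp
  qed (use contig that in auto)
  have "0 < detn (Suc l) (\<lambda>a b. A (r b) (c a))"
  proof (rule minors_pos_of_contiguous_columns[OF _ _ Suc.prems(1), of "\<lambda>a b. A b (c a)"])
    fix \<delta> assume "increasing_seq (Suc l - 1) m \<delta>"
    then have "0 < detn l (\<lambda>a b. A (\<delta> a) (c b))"
      using increasing_seq_mono[OF Suc.prems(2), of l] by (intro Suc.IH) auto
    then show "0 < detn (Suc l - 1) (\<lambda>a b. A (\<delta> b) (c a))"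
      by (simp add: detn_transpose[of l "\<lambda>a b. A (\<delta> a) (c b)"])
  next
    fix i assume "i + Suc l \<le> m"
    then have "0 < detn (Suc l) (\<lambda>a b. A (i + a) (c b))" using Suc.prems(2) by (rule step)
    then show "0 < detn (Suc l) (\<lambda>a b. A (i + b) (c a))"
      by (simp only: detn_transpose[of "Suc l" "\<lambda>a b. A (i + a) (c b)"])
  qed
  then show ?case by (simp only: detn_transpose[of "Suc l" "\<lambda>a b. A (r a) (c b)"])
qed

text \<open>A contiguous minor of a Hankel matrix depends on \<open>i + j\<close> only. According to the parity of
  \<open>i + j\<close> it is a contiguous principal minor of the matrix or of its shift by one column.\<close>
lemma hankel_minors_pos:
  assumes "pd {..<N} (\<lambda>i j. s (i + j))" "pd {..<N-1} (\<lambda>i j. s (Suc (i + j)))"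
    and "increasing_seq k N r" "increasing_seq k N c"
  shows "0 < detn k (\<lambda>a b. s (r a + c b) :: real)"
proof (rule minors_pos_of_contiguous[of N N "\<lambda>i j. s (i + j)", OF _ assms(3,4)])
  fix k i j assume ij: "i + k \<le> N" "j + k \<le> N"
  show "0 < detn k (\<lambda>a b. s (i + a + (j + b)))"
  proof (cases "even (i + j)")
    case True
    then obtain m where m: "i + j = 2 * m" by (rule evenE)
    have "pd {..<k} (\<lambda>a b. s ((m + a) + (m + b)))"
      using ij m by (intro pd_reindex[OF assms(1)]) auto
    then have "0 < detn k (\<lambda>a b. s ((m + a) + (m + b)))" by (rule pd_detn_pos)
    moreover have "(\<lambda>a b. s (i + a + (j + b))) = (\<lambda>a b. s ((m + a) + (m + b)))"
      using m by (intro ext arg_cong[of _ _ s]) linarith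
    ultimately show ?thesis by (simp only:)
  next
    case False
    then obtain m where m: "i + j = 2 * m + 1" by (rule oddE)
    have "pd {..<k} (\<lambda>a b. s (Suc ((m + a) + (m + b))))"
      using ij m by (intro pd_reindex[OF assms(2)]) auto
    then have "0 < detn k (\<lambda>a b. s (Suc ((m + a) + (m + b))))" by (rule pd_detn_pos)
    moreover have "(\<lambda>a b. s (i + a + (j + b))) = (\<lambda>a b. s (Suc ((m + a) + (m + b))))"
      using m by (intro ext arg_cong[of _ _ s]) linarith
    ultimately show ?thesis by (simp only:)
  qed
qed

lemma detn_tendsto:
  assumes "\<And>i j. (\<lambda>n. X n i j) \<longlonglongrightarrow> A i j"
  shows "(\<lambda>n. detn k (X n)) \<longlonglongrightarrow> detn k A"
proof -
  have d: "detn k Y = (\<Sum>p\<in>{p. p permutes {0..<k}}. signof p * (\<Prod>i=0..<k. Y i (p i)))" for Y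
    unfolding detn_def by (subst det_def'[of _ k]) (auto intro!: sum.cong prod.cong simp: permutes_in_image)
  show ?thesis unfolding d by (intro tendsto_sum tendsto_mult_left tendsto_prod assms)
qed

text \<open>The moments of a measure with atoms \<open>1, \<dots>, N\<close> and positive weights: the quadratic form is a
  weighted sum of squares of values of a polynomial of degree below \<open>m\<close>, which cannot vanish at
  all \<open>N\<close> atoms.\<close>
lemma power_moments_pd:
  assumes "m \<le> N" "\<And>x. x \<in> {1..N} \<Longrightarrow> 0 < w x"
  shows "pd {..<m} (\<lambda>i j. \<Sum>x\<in>{1..N}. w x * real x ^ (i + j))"
proof (rule pdI)
  show "(\<Sum>x\<in>{1..N}. w x * real x ^ (i + j)) = (\<Sum>x\<in>{1..N}. w x * real x ^ (j + i))" for i j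
    by (simp add: add.commute)
  fix v :: "nat \<Rightarrow> real" and i assume i: "i \<in> {..<m}" "v i \<noteq> 0"
  define q where "q = (\<lambda>x. \<Sum>i<m. v i * real x ^ i)"
  have eq: "qform {..<m} (\<lambda>i j. \<Sum>x\<in>{1..N}. w x * real x ^ (i + j)) v = (\<Sum>x\<in>{1..N}. w x * (q x)\<^sup>2)"
    unfolding qform_sum qform_scale power_add qform_outer q_def ..
  have nn: "0 \<le> w x * (q x)\<^sup>2" if "x \<in> {1..N}" for x using assms(2)[OF that] by simp
  have "(\<Sum>x\<in>{1..N}. w x * (q x)\<^sup>2) \<noteq> 0"
  proof
    assume "(\<Sum>x\<in>{1..N}. w x * (q x)\<^sup>2) = 0"
    then have "\<forall>x\<in>{1..N}. w x * (q x)\<^sup>2 = 0" by (subst (asm) sum_nonneg_eq_0_iff) (use nn in auto)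
    then have q0: "q x = 0" if "x \<in> {1..N}" for x using assms(2)[OF that] that by fastforce
    have "\<forall>i\<in>{..<m}. v i = 0"
    proof (rule powr_sum_zeros)
      show "inj_on real {..<m}" by simp
      show "card (real ` {1..m}) = card {..<m}" by (simp add: card_image)
      show "real ` {1..m} \<subseteq> {0<..}" by auto
      fix y assume "y \<in> real ` {1..m}"
      then obtain x where x: "y = real x" "x \<in> {1..N}" "x > 0" using assms(1) by auto
      then show "(\<Sum>j\<in>{..<m}. v j * y powr real j) = 0"
        using q0[OF x(2)] by (simp add: q_def powr_realpow)
    qed auto
    then show False using i by auto
  qed
  moreover have "0 \<le> (\<Sum>x\<in>{1..N}. w x * (q x)\<^sup>2)" by (intro sum_nonneg nn)
  ultimately show "0 < qform {..<m} (\<lambda>i j. \<Sum>x\<in>{1..N}. w x * real x ^ (i + j)) v" unfolding eq by simp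
qed

lemma pd_of_psd_add:
  assumes "psd S A" "pd S B" "0 < \<epsilon>"
  shows "pd S (\<lambda>i j. A i j + \<epsilon> * B i j)"
  unfolding pd_def qform_add qform_scale
proof (intro conjI ballI allI impI)
  show "A i j + \<epsilon> * B i j = A j i + \<epsilon> * B j i" if "i \<in> S" "j \<in> S" for i j
    using psd_sym[OF assms(1) that] pd_sym[OF assms(2) that] by simp
  fix v :: "'a \<Rightarrow> real" assume "\<exists>i\<in>S. v i \<noteq> 0"
  then have "0 < qform S B v" using pd_qform[OF assms(2)] by blast
  then show "0 < qform S A v + \<epsilon> * qform S B v"
    using psd_qform[OF assms(1), of v] assms(3) by (intro add_nonneg_pos) auto
qed

text \<open>The semidefinite case follows from the definite one by adding small multiples of the
  moments of a measure that makes both Hankel matrices positive definite.\<close>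
lemma hankel_minors_nonneg:
  fixes s :: "nat \<Rightarrow> real"
  assumes "psd {..<N} (\<lambda>i j. s (i + j))" "psd {..<N-1} (\<lambda>i j. s (Suc (i + j)))"
    and "increasing_seq k N r" "increasing_seq k N c"
  shows "0 \<le> detn k (\<lambda>a b. s (r a + c b))"
proof -
  define p where "p = (\<lambda>m. \<Sum>x\<in>{1..N}. real x ^ m)"
  have pd0: "pd {..<N} (\<lambda>i j. p (i + j))"
    using power_moments_pd[of N N "\<lambda>_. 1"] by (simp add: p_def)
  have pd1: "pd {..<N-1} (\<lambda>i j. p (Suc (i + j)))"
    using power_moments_pd[of "N - 1" N real] by (simp add: p_def)
  define t where "t = (\<lambda>n. inverse (real (Suc n)))"
  have t: "0 < t n" for n by (simp add: t_def)
  have tlim: "t \<longlonglongrightarrow> 0" unfolding t_def by (rule LIMSEQ_inverse_real_of_nat)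
  have "(\<lambda>n. detn k (\<lambda>a b. s (r a + c b) + t n * p (r a + c b))) \<longlonglongrightarrow> detn k (\<lambda>a b. s (r a + c b))"
  proof (rule detn_tendsto)
    fix i j
    have "(\<lambda>n. s (r i + c j) + t n * p (r i + c j)) \<longlonglongrightarrow> s (r i + c j) + 0 * p (r i + c j)"
      by (intro tendsto_intros tlim)
    then show "(\<lambda>n. s (r i + c j) + t n * p (r i + c j)) \<longlonglongrightarrow> s (r i + c j)" by simp
  qed
  moreover have "0 \<le> detn k (\<lambda>a b. s (r a + c b) + t n * p (r a + c b))" for n
    using hankel_minors_pos[of N "\<lambda>m. s m + t n * p m", OF _ _ assms(3,4)]
      pd_of_psd_add[OF assms(1) pd0 t] pd_of_psd_add[OF assms(2) pd1 t] by (simp add: less_imp_le)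
  ultimately show ?thesis by (intro LIMSEQ_le_const) auto
qed

section \<open>Total non-negativity through two semidefinite matrices\<close>

lemma pick_image_increasing_seq:
  assumes "increasing_seq k n r" "a < k"
  shows "pick (r ` {..<k}) a = r a"
proof -
  note inj = increasing_seq_inj_on[OF assms(1)]
  have "{x \<in> r ` {..<k}. x < r a} = r ` {..<a}"
  proof (intro equalityI subsetI)
    fix x assume "x \<in> {x \<in> r ` {..<k}. x < r a}"
    then obtain b where b: "b < k" "x = r b" "r b < r a" by auto
    have "\<not> a < b" using increasing_seq_less[OF assms(1), of a b] b by auto
    moreover have "a \<noteq> b" using b by auto
    ultimately have "b < a" by simp
    then show "x \<in> r ` {..<a}" using b by simp
  next
    fix x assume "x \<in> r ` {..<a}"
    then obtain b where b: "b < a" "x = r b" by auto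
    then show "x \<in> {x \<in> r ` {..<k}. x < r a}"
      using increasing_seq_less[OF assms(1) b(1) assms(2)] assms(2) by auto
  qed
  moreover have "card (r ` {..<a}) = a"
    using assms(2) by (subst card_image) (auto intro: inj_on_subset[OF inj])
  moreover have "pick (r ` {..<k}) (card {x \<in> r ` {..<k}. x < r a}) = r a"
    using assms(2) by (intro pick_card_in_set imageI) simp
  ultimately show ?thesis by (simp only:)
qed

lemma increasing_seq_pick:
  assumes "I \<subseteq> {..<n}"
  shows "increasing_seq (card I) n (pick I)"
  unfolding increasing_seq_def
proof (intro conjI allI impI)
  show "pick I a < pick I b" if "a < b" "b < card I" for a b
    using that by (rule pick_mono_le[rotated])
  show "pick I a < n" if "a < card I" for a
    using pick_in_set_le[OF that] assms by auto
qed

text \<open>Total non-negativity in terms of \<open>detn\<close>: index sets are replaced by their increasing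
  enumerations.\<close>
lemma totally_nonneg_iff:
  assumes "A \<in> carrier_mat N N"
  shows "totally_nonneg A \<longleftrightarrow> (\<forall>k r c. increasing_seq k N r \<longrightarrow> increasing_seq k N c
    \<longrightarrow> 0 \<le> detn k (\<lambda>i j. A $$ (r i, c j)))"
proof -
  have sub: "submatrix A I J = mat (card I) (card J) (\<lambda>(i, j). A $$ (pick I i, pick J j))"
    if "I \<subseteq> {..<N}" "J \<subseteq> {..<N}" for I J
  proof -
    have "{i. i < dim_row A \<and> i \<in> I} = I" "{j. j < dim_col A \<and> j \<in> J} = J" using that assms by auto
    then show ?thesis by (simp add: submatrix_def)
  qed
  show ?thesis
  proof (intro iffI allI impI)
    fix k r c assume tn: "totally_nonneg A" and r: "increasing_seq k N r" and c: "increasing_seq k N c"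
    define I J where "I = r ` {..<k}" and "J = c ` {..<k}"
    have IJ: "I \<subseteq> {..<N}" "J \<subseteq> {..<N}"
      using increasing_seq_bound[OF r] increasing_seq_bound[OF c] by (auto simp: I_def J_def)
    have card: "card I = k" "card J = k" 
      using increasing_seq_inj_on[OF r] increasing_seq_inj_on[OF c] by (auto simp: I_def J_def card_image)
    have "0 \<le> det (submatrix A I J)"
      using tn IJ card assms by (auto simp: totally_nonneg_def)
    also have "det (submatrix A I J) = detn k (\<lambda>i j. A $$ (pick I i, pick J j))"
      unfolding sub[OF IJ] card detn_def ..
    also have "\<dots> = detn k (\<lambda>i j. A $$ (r i, c j))"
      using r c by (intro detn_cong) (simp add: I_def J_def pick_image_increasing_seq)
    finally show "0 \<le> detn k (\<lambda>i j. A $$ (r i, c j))" .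
  next
    assume *: "\<forall>k r c. increasing_seq k N r \<longrightarrow> increasing_seq k N c \<longrightarrow> 0 \<le> detn k (\<lambda>i j. A $$ (r i, c j))"
    show "totally_nonneg A"
      unfolding totally_nonneg_def
    proof (intro allI impI)
      fix I J assume IJ: "I \<subseteq> {..<dim_row A} \<and> J \<subseteq> {..<dim_col A} \<and> card I = card J"
      then have IJ': "I \<subseteq> {..<N}" "J \<subseteq> {..<N}" "card I = card J" using assms by auto
      have "0 \<le> detn (card I) (\<lambda>i j. A $$ (pick I i, pick J j))"
        using * increasing_seq_pick[OF IJ'(1)] increasing_seq_pick[OF IJ'(2)] IJ'(3) by simp
      then show "0 \<le> det (submatrix A I J)"
        unfolding sub[OF IJ'(1,2)] detn_def IJ'(3) .
    qed
  qed
qed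

lemma pos_semidef_iff_psd:
  assumes "A \<in> carrier_mat N N"
  shows "pos_semidef A \<longleftrightarrow> psd {..<N} (\<lambda>i j. A $$ (i, j))"
proof -
  have q: "vec N v \<bullet> (A *\<^sub>v vec N v) = qform {..<N} (\<lambda>i j. A $$ (i, j)) v" for v
    using assms
    by (simp add: qform_def scalar_prod_def atLeast0LessThan sum_distrib_left mult_ac)
  have dims: "dim_row A = N" "dim_col A = N" using assms by auto
  have all: "(\<forall>v\<in>carrier_vec N. 0 \<le> v \<bullet> (A *\<^sub>v v)) \<longleftrightarrow> (\<forall>v. 0 \<le> qform {..<N} (\<lambda>i j. A $$ (i, j)) v)"
  proof (intro iffI allI ballI)
    fix v assume "\<forall>v\<in>carrier_vec N. 0 \<le> v \<bullet> (A *\<^sub>v v)"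
    then have "0 \<le> vec N v \<bullet> (A *\<^sub>v vec N v)" by (rule bspec) simp
    then show "0 \<le> qform {..<N} (\<lambda>i j. A $$ (i, j)) v" unfolding q .
  next
    fix v :: "real vec" assume *: "\<forall>v. 0 \<le> qform {..<N} (\<lambda>i j. A $$ (i, j)) v" and v: "v \<in> carrier_vec N"
    have "vec N (\<lambda>i. v $ i) = v" using v by auto
    then show "0 \<le> v \<bullet> (A *\<^sub>v v)" using * q[of "\<lambda>i. v $ i"] by simp
  qed
  have "transpose_mat A = A \<longleftrightarrow> (\<forall>i\<in>{..<N}. \<forall>j\<in>{..<N}. A $$ (i, j) = A $$ (j, i))"
    (is "?L \<longleftrightarrow> ?R")
  proof
    assume ?L
    show ?R
    proof (intro ballI)
      fix i j assume "i \<in> {..<N}" "j \<in> {..<N}"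
      then have "transpose_mat A $$ (j, i) = A $$ (i, j)" using dims by simp
      then show "A $$ (i, j) = A $$ (j, i)" unfolding \<open>?L\<close> by simp
    qed
  next
    assume ?R
    show ?L
    proof (rule eq_matI)
      fix i j assume "i < dim_row A" "j < dim_col A"
      then show "transpose_mat A $$ (i, j) = A $$ (i, j)" using dims bspec[OF bspec[OF \<open>?R\<close>, of j], of i] by simp
    qed (simp_all add: dims)
  qed
  then show ?thesis using dims all by (simp add: pos_semidef_def psd_def)
qed

lemma hankel_sequence:
  assumes "hankel A" "A \<in> carrier_mat N N"
  shows "\<exists>s. \<forall>i<N. \<forall>j<N. A $$ (i, j) = s (i + j)"
proof (intro exI allI impI)
  fix i j assume ij: "i < N" "j < N"
  (* Each antidiagonal is represented by its lowest entry. *)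
  define k where "k = min (i + j) (N - 1)"
  have k: "k < N" "i + j - k < N" "i + j = k + (i + j - k)" using ij by (auto simp: k_def)
  have "\<forall>i<N. \<forall>j<N. \<forall>k<N. \<forall>l<N. i + j = k + l \<longrightarrow> A $$ (i, j) = A $$ (k, l)"
    using assms(1) unfolding hankel_def carrier_matD[OF assms(2)] .
  then have "A $$ (i, j) = A $$ (k, i + j - k)" using ij k(1,2) k(3) by blast
  then show "A $$ (i, j) = (\<lambda>m. A $$ (min m (N - 1), m - min m (N - 1))) (i + j)"
    by (simp add: k_def)
qed

text \<open>The shifted matrix is the submatrix of rows \<open>0, \<dots>, N - 2\<close> and columns \<open>1, \<dots>, N - 1\<close>, so its
  principal minors are minors of \<open>A\<close>. With \<open>hankel_psd_imp_TN\<close> this characterizes total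
  non-negativity of Hankel matrices.\<close>
lemma hankel_TN_imp_psd:
  assumes A: "A \<in> carrier_mat N N" "totally_nonneg A"
    and s: "\<And>i j. i < N \<Longrightarrow> j < N \<Longrightarrow> A $$ (i, j) = s (i + j)"
  shows "psd {..<N} (\<lambda>i j. s (i + j))" "psd {..<N-1} (\<lambda>i j. s (Suc (i + j)))"
proof -
  have minor: "0 \<le> detn k (\<lambda>i j. s (r i + c j))" if "increasing_seq k N r" "increasing_seq k N c" for k r c
  proof -
    have "0 \<le> detn k (\<lambda>i j. A $$ (r i, c j))" using A that by (simp add: totally_nonneg_iff)
    also have "\<dots> = detn k (\<lambda>i j. s (r i + c j))"
      using that by (intro detn_cong s) (auto dest: increasing_seq_bound)
    finally show ?thesis .
  qed
  show "psd {..<N} (\<lambda>i j. s (i + j))"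
    using minor by (intro psd_of_principal_minors) (simp_all add: add.commute)
  show "psd {..<N-1} (\<lambda>i j. s (Suc (i + j)))"
  proof (rule psd_of_principal_minors)
    fix k r assume "increasing_seq k (N - 1) r"
    then have "increasing_seq k N r" "increasing_seq k N (\<lambda>i. Suc (r i))"
      by (auto simp: increasing_seq_def)
    then show "0 \<le> detn k (\<lambda>i j. s (Suc (r i + r j)))" using minor by fastforce
  qed (simp add: add.commute)
qed

lemma hankel_psd_imp_TN:
  assumes A: "A \<in> carrier_mat N N"
    and s: "\<And>i j. i < N \<Longrightarrow> j < N \<Longrightarrow> A $$ (i, j) = s (i + j)"
    and psd: "psd {..<N} (\<lambda>i j. s (i + j))" "psd {..<N-1} (\<lambda>i j. s (Suc (i + j)))"
  shows "totally_nonneg A"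
  unfolding totally_nonneg_iff[OF A]
proof (intro allI impI)
  fix k r c assume r: "increasing_seq k N r" "increasing_seq k N c"
  have "0 \<le> detn k (\<lambda>i j. s (r i + c j))" by (rule hankel_minors_nonneg[OF psd r])
  also have "\<dots> = detn k (\<lambda>i j. A $$ (r i, c j))"
    using r by (intro detn_cong s[symmetric]) (auto dest: increasing_seq_bound)
  finally show "0 \<le> detn k (\<lambda>i j. A $$ (r i, c j))" .
qed

text \<open>The entrywise image of a Hankel matrix is Hankel, and so is that of its shift; the
  characterization by two semidefinite matrices therefore reduces total non-negativity to
  positivity. The shift has size \<open>N - 1\<close>, and is bordered by zeros to fit into dimension \<open>N\<close>.\<close>
lemma map_mat_hankel_TN:
  assumes A: "A \<in> HTN N {0..\<rho>}" and rho: "\<rho> > 0"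
    and f: "\<And>B. psd {..<N} B \<Longrightarrow> (\<And>i k. i < N \<Longrightarrow> k < N \<Longrightarrow> B i k \<in> {0..\<rho>}) \<Longrightarrow> psd {..<N} (\<lambda>i k. f (B i k))"
  shows "totally_nonneg (map_mat f A)"
proof -
  have A': "A \<in> carrier_mat N N" "hankel A" "totally_nonneg A" "elements_mat A \<subseteq> {0..\<rho>}"
    using A by (auto simp: HTN_def)
  obtain s where s: "\<And>i j. i < N \<Longrightarrow> j < N \<Longrightarrow> A $$ (i, j) = s (i + j)"
    using hankel_sequence[OF A'(2,1)] by blast
  have range: "s (i + j) \<in> {0..\<rho>}" if "i < N" "j < N" for i j
  proof -
    have "A $$ (i, j) \<in> elements_mat A" using that A'(1) by (intro elements_matI) auto
    then show ?thesis using A'(4) s[OF that] by auto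
  qed
  note psd = hankel_TN_imp_psd[OF A'(1,3) s]
  define B where "B = (\<lambda>i j. if i < N - 1 \<and> j < N - 1 then s (Suc (i + j)) else 0)"
  have sB: "s (Suc (i + j)) = B i j" if "i \<in> {..<N-1}" "j \<in> {..<N-1}" for i j
    using that by (simp add: B_def)
  have "psd {..<N-1} B"
    using psd(2) psd_cong[of "{..<N-1}" "\<lambda>i j. s (Suc (i + j))" B, OF sB] by blast
  then have "psd {..<N} B"
    by (subst psd_zero_row[of _ "{..<N-1}"]) (auto simp: B_def)
  moreover have "B i k \<in> {0..\<rho>}" if "i < N" "k < N" for i k
    using range[of "Suc i" k] rho that by (auto simp: B_def)
  ultimately have "psd {..<N} (\<lambda>i k. f (B i k))" by (rule f)
  then have "psd {..<N-1} (\<lambda>i k. f (B i k))" by (rule psd_subset) auto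
  then have shifted: "psd {..<N-1} (\<lambda>i j. f (s (Suc (i + j))))"
    using psd_cong[of "{..<N-1}" "\<lambda>i j. f (s (Suc (i + j)))" "\<lambda>i j. f (B i j)", OF arg_cong[OF sB]] by blast
  have "psd {..<N} (\<lambda>i j. f (s (i + j)))" using range by (intro f psd(1))
  with shifted show ?thesis
    using A'(1) s by (intro hankel_psd_imp_TN[of _ N "\<lambda>m. f (s m)"]) auto
qed

text \<open>A Hankel matrix is symmetric, so its principal minors decide.\<close>
lemma preserves_TN_imp_positivity:
  assumes "S \<subseteq> HTN N I" "preserves_TN f S"
  shows "preserves_positivity f S"
  unfolding preserves_positivity_def
proof
  fix A assume "A \<in> S"
  then have A: "A \<in> carrier_mat N N" "hankel A" and tn: "totally_nonneg (map_mat f A)"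
    using assms by (auto simp: HTN_def preserves_TN_def)
  obtain s where s: "\<And>i j. i < N \<Longrightarrow> j < N \<Longrightarrow> A $$ (i, j) = s (i + j)"
    using hankel_sequence[OF A(2,1)] by blast
  have fA: "map_mat f A \<in> carrier_mat N N" using A by simp
  have fs: "map_mat f A $$ (i, j) = f (s (i + j))" if "i < N" "j < N" for i j
    using A(1) s[OF that] that by simp
  have "psd {..<N} (\<lambda>i j. f (s (i + j)))"
    by (rule hankel_TN_imp_psd(1)[OF fA tn, of "\<lambda>m. f (s m)"]) (rule fs)
  then have "psd {..<N} (\<lambda>i j. map_mat f A $$ (i, j))"
    using psd_cong[of "{..<N}" "\<lambda>i j. map_mat f A $$ (i, j)" "\<lambda>i j. f (s (i + j))"] fs by blast
  then show "pos_semidef (map_mat f A)" unfolding pos_semidef_iff_psd[OF fA] .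
qed

section \<open>Geometric test matrices and necessity\<close>

lemma rank_outer_product:
  fixes A :: "real mat"
  assumes A: "A \<in> carrier_mat N N" and N: "N > 0"
    and uw: "\<And>i j. i < N \<Longrightarrow> j < N \<Longrightarrow> A $$ (i, j) = u i * w j" "A $$ (0, 0) \<noteq> 0"
  shows "vec_space.rank N A = 1"
proof -
  interpret vec_space "TYPE(real)" N .
  have "rank A \<le> 1"
    using A uw(1) by (intro rank_le_1_product_entries[OF A, of u w]) auto
  moreover have "card {col A 0} \<le> rank A"
  proof (rule rank_ge_card_indpt[OF A])
    show "{col A 0} \<subseteq> set (cols A)" using A N by (auto simp: cols_def)
    have v: "col A 0 \<in> carrier_vec N" using A by auto
    have "col A 0 $ 0 \<noteq> 0" using A N uw(2) by simp
    then have "col A 0 \<noteq> 0\<^sub>v N" using N by auto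
    then have "col A 0 \<notin> span {}" by (simp add: span_empty)
    moreover have "lin_indpt {}"
      by (metis empty_subsetI fin_dim finite_basis_exists subset_li_is_li vec_vs vectorspace.basis_def)
    ultimately have "\<not> lin_dep ({} \<union> {col A 0})"
      using lin_dep_iff_in_span[of "{}" "col A 0"] v by simp
    then show "lin_indpt {col A 0}" by simp
  qed
  ultimately show ?thesis by simp
qed

lemma geometric_hankel_HTN_rank1:
  assumes N: "N > 0" and a: "0 < a" "a < \<rho>" and r: "0 < r" "r < 1"
  shows "mat N N (\<lambda>(i, j). a * r ^ (i + j)) \<in> HTN_rank1 N {0<..<\<rho>}"
proof -
  define A where "A = mat N N (\<lambda>(i, j). a * r ^ (i + j))"
  have A: "A \<in> carrier_mat N N" by (simp add: A_def)
  have A_ij: "A $$ (i, j) = a * r ^ (i + j)" if "i < N" "j < N" for i j using that by (simp add: A_def)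
  have p: "psd S (\<lambda>i j. b * r ^ (i + j))" if "b \<ge> 0" for b S
    using psd_scale[OF psd_outer that, of S "\<lambda>i. r ^ i"] by (simp add: power_add)
  have "totally_nonneg A"
  proof (rule hankel_psd_imp_TN[OF A A_ij])
    show "psd {..<N} (\<lambda>i j. a * r ^ (i + j))" using a by (intro p) simp
    show "psd {..<N-1} (\<lambda>i j. a * r ^ Suc (i + j))"
      using p[of "a * r"] a r by (simp add: mult.assoc)
  qed
  moreover have "hankel A" using A A_ij by (auto simp: hankel_def)
  moreover have "elements_mat A \<subseteq> {0<..<\<rho>}"
  proof
    fix x assume "x \<in> elements_mat A"
    then obtain i j where "i < N" "j < N" "x = A $$ (i, j)" using A by auto
    then have x: "x = a * r ^ (i + j)" by (simp only: A_ij)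
    have "r ^ (i + j) \<le> 1" using r by (intro power_le_one) auto
    then have "x \<le> a" using a unfolding x by (simp add: mult_left_le)
    moreover have "0 < x" using a r by (simp add: x)
    ultimately show "x \<in> {0<..<\<rho>}" using a(2) by simp
  qed
  moreover have "vec_space.rank N A = 1"
    using A_ij a r N by (intro rank_outer_product[OF A N, of "\<lambda>i. a * r ^ i" "\<lambda>j. r ^ j"])
      (auto simp: power_add)
  ultimately show ?thesis using A unfolding A_def by (simp add: HTN_rank1_def HTN_def)
qed

lemma poly_eq_sum_lessThan:
  fixes q :: "real poly"
  assumes "degree q < N"
  shows "poly q x = (\<Sum>i<N. coeff q i * x ^ i)"
  unfolding poly_altdef using assms by (intro sum.mono_neutral_left) (auto simp: coeff_eq_0)

text \<open>The test matrices \<open>a * r ^ (i + j)\<close> turn \<open>x powr e\<close> into the rank-one matrix of the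
  geometric sequence with ratio \<open>r powr e\<close>. Pairing that sequence with the coefficient vector of a
  polynomial \<open>q\<close> evaluates \<open>q\<close> at \<open>r powr e\<close>, so that vectors can be designed by prescribing the
  values of \<open>q\<close>.\<close>
lemma entrywise_geometric_form_nonneg:
  fixes n c :: "nat \<Rightarrow> real" and q :: "real poly"
  assumes f: "f = (\<lambda>x. (\<Sum>j<N. c j * rpow x (n j)) + c' * rpow x M)"
    and pp: "preserves_positivity f (HTN_rank1 N {0<..<\<rho>})"
    and q: "degree q < N" and a: "0 < a" "a < \<rho>" and r: "0 < r" "r < 1"
  shows "0 \<le> (\<Sum>j<N. c j * a powr n j * (poly q (r powr n j))\<^sup>2) + c' * a powr M * (poly q (r powr M))\<^sup>2"
proof -
  define A where "A = mat N N (\<lambda>(i, j). a * r ^ (i + j))"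
  have "A \<in> HTN_rank1 N {0<..<\<rho>}" unfolding A_def using q a r by (intro geometric_hankel_HTN_rank1) auto
  then have "pos_semidef (map_mat f A)" using pp by (simp add: preserves_positivity_def)
  then have "psd {..<N} (\<lambda>i j. map_mat f A $$ (i, j))"
    by (subst (asm) pos_semidef_iff_psd[of _ N]) (simp_all add: A_def)
  then have "0 \<le> qform {..<N} (\<lambda>i j. map_mat f A $$ (i, j)) (coeff q)" by (rule psd_qform)
  also have "\<dots> = qform {..<N} (\<lambda>i k. (\<Sum>j<N. (c j * a powr n j) * ((r powr n j) ^ i * (r powr n j) ^ k))
      + (c' * a powr M) * ((r powr M) ^ i * (r powr M) ^ k)) (coeff q)"
  proof -
    have "rpow (a * r ^ (i + k)) e = a powr e * ((r powr e) ^ i * (r powr e) ^ k)" for i k e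
      using a r by (simp add: rpow_pos powr_mult powr_realpow[symmetric] powr_powr powr_add mult.commute distrib_right)
    then show ?thesis unfolding qform_def by (intro sum.cong refl) (simp add: A_def f mult.assoc)
  qed
  also have "\<dots> = (\<Sum>j<N. c j * a powr n j * (poly q (r powr n j))\<^sup>2) + c' * a powr M * (poly q (r powr M))\<^sup>2"
    unfolding qform_add qform_sum qform_scale qform_outer poly_eq_sum_lessThan[OF q] ..
  finally show ?thesis .
qed

lemma poly_prod_linear: "poly (\<Prod>k\<in>K. [:- x k, 1:]) t = (\<Prod>k\<in>K. t - x k)" for t :: real
  by (simp add: poly_prod)

lemma degree_prod_linear_le:
  fixes x :: "'a \<Rightarrow> real"
  assumes "finite K"
  shows "degree (\<Prod>k\<in>K. [:- x k, 1:]) \<le> card K"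
  using degree_prod_sum_le[OF assms, of "\<lambda>k. [:- x k, 1:]"] by simp

lemma powr_tendsto_0_at_right: "0 < p \<Longrightarrow> ((\<lambda>a::real. a powr p) \<longlongrightarrow> 0) (at_right 0)"
proof (rule tendsto_zero_powrI[where b = p])
  show "\<forall>\<^sub>F x in at_right 0. 0 \<le> (x :: real)"
    using eventually_at_right_less[of "0 :: real"] by (rule eventually_mono) simp
  show "((\<lambda>x::real. x) \<longlongrightarrow> 0) (at_right 0)" by (rule tendsto_ident_at)
qed auto

text \<open>If \<open>q\<close> vanishes at the nodes of the exponents below \<open>n j\<close>, the term of \<open>n j\<close> dominates as
  \<open>a\<close> tends to 0. This is possible because \<open>q\<close> may have any \<open>N - 1\<close> zeros.\<close>
lemma preserver_coefficient_nonneg: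
  fixes n c :: "nat \<Rightarrow> real"
  assumes f: "f = (\<lambda>x. (\<Sum>j<N. c j * rpow x (n j)) + c' * rpow x M)"
    and pp: "preserves_positivity f (HTN_rank1 N {0<..<\<rho>})"
    and less: "\<And>i j. i < j \<Longrightarrow> j < N \<Longrightarrow> n i < n j" and M: "\<And>j. j < N \<Longrightarrow> n j < M"
    and rho: "\<rho> > 0" and j: "j < N"
  shows "0 \<le> c j"
proof -
  define r :: real where "r = 1 / 2"
  define q where "q = (\<Prod>k<j. [:- (r powr n k), 1:])"
  define Q where "Q = (\<lambda>e. poly q (r powr e))"
  have Qe: "Q e = (\<Prod>k<j. r powr e - r powr n k)" for e
    unfolding Q_def q_def by (rule poly_prod_linear)
  have deg: "degree q < N"
    using degree_prod_linear_le[of "{..<j}" "\<lambda>k. r powr n k"] j by (simp add: q_def)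
  have Q0: "Q (n i) = 0" if "i < j" for i unfolding Qe using that by (intro prod_zero) auto
  have rinj: "r powr s \<noteq> r powr t" if "s \<noteq> t" for s t using that by (simp add: r_def powr_inj)
  have "r powr n j - r powr n k \<noteq> 0" if "k < j" for k
    using rinj[of "n j" "n k"] less[OF that j] by simp
  then have Qj: "Q (n j) \<noteq> 0" unfolding Qe by simp
  define h where "h = (\<lambda>a. (\<Sum>i<N. c i * (Q (n i))\<^sup>2 * a powr (n i - n j)) + c' * (Q M)\<^sup>2 * a powr (M - n j))"
  have "(h \<longlongrightarrow> (\<Sum>i<N. if i = j then c j * (Q (n j))\<^sup>2 else 0) + c' * (Q M)\<^sup>2 * 0) (at_right 0)"
    unfolding h_def
  proof (intro tendsto_add tendsto_sum tendsto_mult_left powr_tendsto_0_at_right)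
    show "0 < M - n j" using M[OF j] by simp
    fix i assume "i \<in> {..<N}"
    then consider "i < j" | "i = j" | "j < i" "i < N" by fastforce
    then show "((\<lambda>a. c i * (Q (n i))\<^sup>2 * a powr (n i - n j)) \<longlongrightarrow> (if i = j then c j * (Q (n j))\<^sup>2 else 0)) (at_right 0)"
    proof cases
      case 1
      then show ?thesis using Q0 by simp
    next
      case 2
      have "\<forall>\<^sub>F a in at_right 0. c j * (Q (n j))\<^sup>2 = c i * (Q (n i))\<^sup>2 * a powr (n i - n j)"
        using eventually_at_right_less[of "0 :: real"] by (rule eventually_mono) (simp add: 2)
      then show ?thesis unfolding 2 using tendsto_const by (auto intro: Lim_transform_eventually)
    next
      case 3
      then have "((\<lambda>a. c i * (Q (n i))\<^sup>2 * a powr (n i - n j)) \<longlongrightarrow> c i * (Q (n i))\<^sup>2 * 0) (at_right 0)"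
        using less by (intro tendsto_mult_left powr_tendsto_0_at_right) simp
      then show ?thesis using 3 by simp
    qed
  qed
  then have lim: "(h \<longlongrightarrow> c j * (Q (n j))\<^sup>2) (at_right 0)" using j by simp
  have "\<forall>\<^sub>F a in at_right 0. 0 \<le> h a"
    unfolding eventually_at_right_field
  proof (intro exI[of _ \<rho>] conjI rho allI impI)
    fix a assume a: "0 < a" "a < \<rho>"
    have "0 \<le> (\<Sum>j<N. c j * a powr n j * (Q (n j))\<^sup>2) + c' * a powr M * (Q M)\<^sup>2"
      unfolding Q_def by (rule entrywise_geometric_form_nonneg[OF f pp deg a]) (auto simp: r_def)
    also have "\<dots> = a powr n j * h a"
    proof -
      have "a powr e = a powr n j * a powr (e - n j)" for e by (simp add: powr_add[symmetric])
      then have "c i * a powr e * s = a powr n j * (c i * s * a powr (e - n j))"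
        "c' * a powr e * s = a powr n j * (c' * s * a powr (e - n j))" for i e s
        by (metis mult.assoc mult.commute)+
      then show ?thesis unfolding h_def distrib_left sum_distrib_left by (simp only:)
    qed
    finally show "0 \<le> h a" using a by (simp add: zero_le_mult_iff)
  qed
  with lim have "0 \<le> c j * (Q (n j))\<^sup>2" by (intro tendsto_lowerbound[OF lim]) auto
  then show ?thesis using Qj by (simp add: zero_le_mult_iff)
qed

text \<open>If \<open>c j\<close> were zero, a polynomial vanishing at the remaining \<open>N - 1\<close> nodes would leave only
  the negative term of \<open>M\<close>.\<close>
lemma preserver_coefficient_nonzero:
  fixes n c :: "nat \<Rightarrow> real"
  assumes f: "f = (\<lambda>x. (\<Sum>j<N. c j * rpow x (n j)) + c' * rpow x M)"
    and pp: "preserves_positivity f (HTN_rank1 N {0<..<\<rho>})"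
    and M: "\<And>j. j < N \<Longrightarrow> n j < M" and rho: "\<rho> > 0" and c': "c' < 0" and j: "j < N"
  shows "c j \<noteq> 0"
proof
  assume cj: "c j = 0"
  define r :: real where "r = 1 / 2"
  define a where "a = \<rho> / 2"
  define q where "q = (\<Prod>k\<in>{..<N} - {j}. [:- (r powr n k), 1:])"
  have Qe: "poly q (r powr e) = (\<Prod>k\<in>{..<N} - {j}. r powr e - r powr n k)" for e
    unfolding q_def by (rule poly_prod_linear)
  have deg: "degree q < N"
    using degree_prod_linear_le[of "{..<N} - {j}" "\<lambda>k. r powr n k"] j by (simp add: q_def)
  have rinj: "r powr s \<noteq> r powr t" if "s \<noteq> t" for s t using that by (simp add: r_def powr_inj)
  have "poly q (r powr n i) = 0" if "i < N" "i \<noteq> j" for i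
    unfolding Qe using that by (intro prod_zero) auto
  then have "c i * a powr n i * (poly q (r powr n i))\<^sup>2 = 0" if "i < N" for i
    using that cj by (cases "i = j") auto
  then have "(\<Sum>i<N. c i * a powr n i * (poly q (r powr n i))\<^sup>2) = 0" by (intro sum.neutral) auto
  moreover have "0 \<le> (\<Sum>i<N. c i * a powr n i * (poly q (r powr n i))\<^sup>2) + c' * a powr M * (poly q (r powr M))\<^sup>2"
    by (rule entrywise_geometric_form_nonneg[OF f pp deg]) (use rho in \<open>auto simp: r_def a_def\<close>)
  moreover have "poly q (r powr M) \<noteq> 0"
    unfolding Qe using M by (auto intro!: rinj simp: less_imp_neq[symmetric] less_imp_neq)
  moreover have "a powr M > 0" using rho by (simp add: a_def)
  ultimately show False using c' by (simp add: zero_le_mult_iff)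
qed

definition lagrange_poly :: "nat set \<Rightarrow> (nat \<Rightarrow> real) \<Rightarrow> nat \<Rightarrow> real poly" where
  "lagrange_poly I x j = Polynomial.smult (inverse (\<Prod>i\<in>I-{j}. x j - x i)) (\<Prod>i\<in>I-{j}. [:- x i, 1:])"

lemma poly_lagrange_poly: "poly (lagrange_poly I x j) t = lagrange I x j t"
  unfolding lagrange_poly_def lagrange_def prod_dividef poly_smult poly_prod_linear
  by (simp add: divide_inverse)

lemma lagrange_at_node:
  assumes "finite I" "inj_on x I" "j \<in> I" "k \<in> I"
  shows "lagrange I x j (x k) = (if k = j then 1 else 0)"
proof (cases "k = j")
  case True
  have "x j - x i \<noteq> 0" if "i \<in> I - {j}" for i using assms(2,3) that by (auto simp: inj_on_def)
  then show ?thesis using True by (simp add: lagrange_def)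
next
  case False
  have "lagrange I x j (x k) = 0"
    unfolding lagrange_def using assms False by (intro prod_zero) auto
  then show ?thesis using False by simp
qed

text \<open>The values of \<open>q\<close> at the \<open>N\<close> nodes are chosen in the equality case of the Cauchy-Schwarz
  inequality; Lagrange interpolation then gives its value at \<open>r powr M\<close>.\<close>
lemma preserver_geometric_threshold:
  fixes n c :: "nat \<Rightarrow> real"
  assumes f: "f = (\<lambda>x. (\<Sum>j<N. c j * rpow x (n j)) + c' * rpow x M)"
    and pp: "preserves_positivity f (HTN_rank1 N {0<..<\<rho>})"
    and N: "N > 0" and inj: "inj_on n {..<N}" and M: "\<And>j. j < N \<Longrightarrow> n j < M"
    and c: "\<And>j. j < N \<Longrightarrow> 0 < c j" and a: "0 < a" "a < \<rho>" and r: "0 < r" "r < 1"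
  shows "0 \<le> 1 + c' * (\<Sum>j<N. (lagrange {..<N} (\<lambda>i. r powr n i) j (r powr M))\<^sup>2 * a powr (M - n j) / c j)"
proof -
  define x where "x = (\<lambda>i. r powr n i)"
  define \<Lambda> where "\<Lambda> = (\<lambda>j. lagrange {..<N} x j (r powr M))"
  have rinj: "r powr s \<noteq> r powr t" if "s \<noteq> t" for s t using that r by (simp add: powr_inj)
  have xinj: "inj_on x {..<N}" using inj rinj unfolding x_def inj_on_def by blast
  (* The equality case of the weighted Cauchy-Schwarz inequality. *)
  define y where "y = (\<lambda>j. \<Lambda> j / (c j * a powr n j))"
  define q where "q = (\<Sum>j<N. Polynomial.smult (y j) (lagrange_poly {..<N} x j))"
  define S where "S = (\<Sum>j<N. (\<Lambda> j)\<^sup>2 / (c j * a powr n j))"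
  have deg: "degree q < N"
  proof -
    have "degree (Polynomial.smult (y j) (lagrange_poly {..<N} x j)) \<le> N - 1" if "j \<in> {..<N}" for j
      using degree_prod_linear_le[of "{..<N} - {j}" x] that
        order_trans[OF degree_smult_le order_trans[OF degree_smult_le, of _ "N - 1"]]
      by (simp add: lagrange_poly_def)
    then have "degree q \<le> N - 1" unfolding q_def by (intro degree_sum_le) auto
    then show ?thesis using N by simp
  qed
  have qn: "poly q (x k) = y k" if "k < N" for k
  proof -
    have "poly q (x k) = (\<Sum>j<N. y j * lagrange {..<N} x j (x k))"
      by (simp add: q_def poly_sum poly_lagrange_poly)
    also have "\<dots> = (\<Sum>j<N. if j = k then y j else 0)"
      using that by (intro sum.cong refl) (simp add: lagrange_at_node[OF _ xinj])
    finally show ?thesis using that by simp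
  qed
  have qM: "poly q (r powr M) = S"
    by (simp add: q_def poly_sum poly_lagrange_poly S_def y_def \<Lambda>_def power2_eq_square)
  have "(\<Sum>j<N. c j * a powr n j * (poly q (x j))\<^sup>2) = S"
    unfolding S_def
  proof (rule sum.cong[OF refl])
    fix j assume "j \<in> {..<N}"
    then have "c j > 0" "poly q (x j) = y j" using c qn by auto
    then show "c j * a powr n j * (poly q (x j))\<^sup>2 = (\<Lambda> j)\<^sup>2 / (c j * a powr n j)"
      using a by (simp add: y_def power2_eq_square)
  qed
  moreover have "0 \<le> (\<Sum>j<N. c j * a powr n j * (poly q (x j))\<^sup>2) + c' * a powr M * (poly q (r powr M))\<^sup>2"
    unfolding x_def by (rule entrywise_geometric_form_nonneg[OF f pp deg a r])
  ultimately have "0 \<le> S + c' * a powr M * S\<^sup>2" by (simp add: qM)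
  also have "\<dots> = S * (1 + c' * (a powr M * S))" by (simp add: power2_eq_square algebra_simps)
  finally have SS: "0 \<le> S * (1 + c' * (a powr M * S))" .
  have "S > 0"
  proof -
    have "\<Lambda> j \<noteq> 0" if "j < N" for j
    proof -
      have "(r powr M - x i) / (x j - x i) \<noteq> 0" if i: "i \<in> {..<N} - {j}" for i
        using rinj[of M "n i"] M[of i] i inj_onD[OF xinj, of j i] \<open>j < N\<close> by (auto simp: x_def)
      then show ?thesis by (simp add: \<Lambda>_def lagrange_def)
    qed
    then show ?thesis
      unfolding S_def using N c a by (intro sum_pos) auto
  qed
  with SS have "0 \<le> 1 + c' * (a powr M * S)" by (simp add: zero_le_mult_iff)
  (* The common factor turns the weights into those of the cost. *)
  also have "a powr M * S = (\<Sum>j<N. (\<Lambda> j)\<^sup>2 * a powr (M - n j) / c j)"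
    unfolding S_def sum_distrib_left using a by (intro sum.cong refl) (simp add: powr_diff mult.commute)
  finally show ?thesis by (simp add: \<Lambda>_def x_def)
qed

text \<open>Each factor is a quotient of two difference quotients at 1.\<close>
lemma lagrange_powr_tendsto:
  assumes "inj_on n I" "j \<in> I"
  shows "((\<lambda>r. lagrange I (\<lambda>i. r powr n i) j (r powr M)) \<longlongrightarrow> lagrange I n j M) (at_left 1)"
  unfolding lagrange_def
proof (rule tendsto_prod)
  fix i assume i: "i \<in> I - {j}"
  have quot: "((\<lambda>r. (r powr s - r powr t) / (r - 1)) \<longlongrightarrow> s - t) (at_left 1)" for s t :: real
  proof -
    have "((\<lambda>r. r powr s - r powr t) has_real_derivative (s * 1 powr (s - 1) - t * 1 powr (t - 1))) (at 1)"
      by (intro DERIV_diff has_real_derivative_powr) simp_all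
    then have "((\<lambda>r. (r powr s - r powr t) / (r - 1)) \<longlongrightarrow> s - t) (at 1)"
      by (simp add: has_field_derivative_iff)
    then show ?thesis by (rule tendsto_mono[rotated]) (rule at_le, simp)
  qed
  have "n j - n i \<noteq> 0" using assms i by (auto simp: inj_on_def)
  then have "((\<lambda>r. ((r powr M - r powr n i) / (r - 1)) / ((r powr n j - r powr n i) / (r - 1)))
      \<longlongrightarrow> (M - n i) / (n j - n i)) (at_left 1)"
    by (intro tendsto_divide quot)
  moreover have "\<forall>\<^sub>F r in at_left 1. ((r powr M - r powr n i) / (r - 1)) / ((r powr n j - r powr n i) / (r - 1))
      = (r powr M - r powr n i) / (r powr n j - r powr n i)"
    using eventually_at_left_real[of 0 1] by (rule eventually_mono) auto
  ultimately show "((\<lambda>r. (r powr M - r powr n i) / (r powr n j - r powr n i))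
      \<longlongrightarrow> (M - n i) / (n j - n i)) (at_left 1)"
    by (rule Lim_transform_eventually)
qed

text \<open>The limit \<open>r \<rightarrow> 1\<close> with \<open>a = \<rho> * r\<close>, which stays below \<open>\<rho>\<close>.\<close>
lemma preserver_threshold:
  fixes n c :: "nat \<Rightarrow> real"
  assumes f: "f = (\<lambda>x. (\<Sum>j<N. c j * rpow x (n j)) + c' * rpow x M)"
    and pp: "preserves_positivity f (HTN_rank1 N {0<..<\<rho>})"
    and N: "N > 0" and inj: "inj_on n {..<N}" and M: "\<And>j. j < N \<Longrightarrow> n j < M"
    and c: "\<And>j. j < N \<Longrightarrow> 0 < c j" and rho: "\<rho> > 0"
  shows "0 \<le> 1 + c' * rank_one_cost {..<N} n c M \<rho>"
proof (rule tendsto_lowerbound)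
  let ?g = "\<lambda>r. 1 + c' * (\<Sum>j<N. (lagrange {..<N} (\<lambda>i. r powr n i) j (r powr M))\<^sup>2 * (\<rho> * r) powr (M - n j) / c j)"
  have "((\<lambda>r. (\<rho> * r) powr (M - n j)) \<longlongrightarrow> (\<rho> * 1) powr (M - n j)) (at_left 1)" for j
    using rho by (intro tendsto_powr tendsto_mult_left tendsto_ident_at tendsto_const) auto
  then show "(?g \<longlongrightarrow> 1 + c' * rank_one_cost {..<N} n c M \<rho>) (at_left 1)"
    unfolding rank_one_cost_def using c
    by (intro tendsto_add tendsto_const tendsto_mult_left tendsto_sum tendsto_divide tendsto_mult
          tendsto_power lagrange_powr_tendsto inj) (fastforce simp: less_imp_neq[symmetric])+
  show "\<forall>\<^sub>F r in at_left 1. 0 \<le> ?g r"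
    using eventually_at_left_real[of 0 1]
  proof (rule eventually_mono)
    fix r :: real assume "r \<in> {0<..<1}"
    then show "0 \<le> ?g r"
      using rho by (intro preserver_geometric_threshold[OF f pp N inj M c]) (auto simp: mult_less_cancel_left1)
  qed simp
qed simp

section \<open>Vandermonde ratios as Lagrange coefficients\<close>

lemma prod_map_upt: "prod_list (map g [a..<b]) = (\<Prod>i\<in>{a..<b}. g i)"
  by (simp add: prod.distinct_set_conv_list[symmetric])

lemma vandermonde_snoc: "vandermonde (xs @ [x]) = vandermonde xs * prod_list (map (\<lambda>y. x - y) xs)"
proof -
  have "prod_list (map (\<lambda>y. x - y) xs) = (\<Prod>i<length xs. x - xs ! i)"
    by (simp add: prod.list_conv_set_nth atLeast0LessThan)
  then show ?thesis by (simp add: vandermonde_def nth_append)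
qed

text \<open>The factors that contain \<open>y\<close>; for the entries behind \<open>y\<close> the sign is opposite to the one in
  a Lagrange coefficient, which is immaterial after squaring.\<close>
lemma vandermonde_insert:
  "vandermonde (xs @ y # ys)
    = vandermonde (xs @ ys) * prod_list (map (\<lambda>x. y - x) xs) * prod_list (map (\<lambda>z. z - y) ys)"
proof (induction ys rule: rev_induct)
  case Nil
  then show ?case using vandermonde_snoc[of xs y] by simp
next
  case (snoc z ys)
  then show ?case
    using vandermonde_snoc[of "xs @ y # ys" z] vandermonde_snoc[of "xs @ ys" z] by simp
qed

lemma vandermonde_nonzero:
  assumes "distinct xs"
  shows "vandermonde xs \<noteq> 0"
proof -
  have "xs ! j - xs ! i \<noteq> 0" if "j < length xs" "i < j" for i j
    using assms that nth_eq_iff_index_eq[OF assms, of j i] by simp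
  then show ?thesis by (auto simp: vandermonde_def)
qed

text \<open>The factors among the exponents other than \<open>n j\<close> cancel.\<close>
lemma vandermonde_ratio:
  assumes inj: "inj_on n {..<N}" and j: "j < N"
  shows "(vandermonde (map n ([0..<j] @ [Suc j..<N]) @ [M]))\<^sup>2 / (vandermonde (map n [0..<N]))\<^sup>2
    = (lagrange {..<N} n j M)\<^sup>2"
proof -
  define V where "V = vandermonde (map n ([0..<j] @ [Suc j..<N]))"
  have D: "{..<N} - {j} = {0..<j} \<union> {Suc j..<N}" using j by auto
  have disj: "{0..<j} \<inter> {Suc j..<N} = {}" by auto
  have P: "(\<Prod>i\<in>{..<N} - {j}. g i) = (\<Prod>i\<in>{0..<j}. g i) * (\<Prod>i\<in>{Suc j..<N}. g i)" for g :: "nat \<Rightarrow> real"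
    unfolding D by (intro prod.union_disjoint disj) auto
  have "vandermonde (map n ([0..<j] @ [Suc j..<N]) @ [M]) = V * (\<Prod>i\<in>{..<N} - {j}. M - n i)"
    unfolding V_def vandermonde_snoc P by (simp add: comp_def prod_map_upt)
  moreover have "(vandermonde (map n [0..<N]))\<^sup>2 = V\<^sup>2 * (\<Prod>i\<in>{..<N} - {j}. n j - n i)\<^sup>2"
  proof -
    have "[0..<N] = [0..<j] @ j # [Suc j..<N]"
      using j upt_add_eq_append[of 0 j "N - j"] upt_conv_Cons[of j N] by simp
    then have "vandermonde (map n [0..<N]) = V * (\<Prod>i\<in>{0..<j}. n j - n i) * (\<Prod>i\<in>{Suc j..<N}. n i - n j)"
      using vandermonde_insert[of "map n [0..<j]" "n j" "map n [Suc j..<N]"]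
      by (simp add: V_def comp_def prod_map_upt)
    moreover have "(\<Prod>i\<in>{Suc j..<N}. n i - n j)\<^sup>2 = (\<Prod>i\<in>{Suc j..<N}. n j - n i)\<^sup>2"
      unfolding prod_power_distrib by (intro prod.cong refl power2_commute)
    ultimately show ?thesis by (simp add: P power_mult_distrib)
  qed
  moreover have "V \<noteq> 0"
  proof -
    have "distinct ([0..<j] @ [Suc j..<N])" by auto
    moreover have "inj_on n (set ([0..<j] @ [Suc j..<N]))"
      by (rule inj_on_subset[OF inj]) (use j in auto)
    ultimately have "distinct (map n ([0..<j] @ [Suc j..<N]))"
      unfolding distinct_map by (rule conjI)
    then show ?thesis unfolding V_def by (rule vandermonde_nonzero)
  qed
  ultimately show ?thesis
    by (simp add: lagrange_def prod_dividef power_mult_distrib power_divide)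
qed

section \<open>The equivalence\<close>

theorem theorem9p4:
  fixes N :: nat and n c :: "nat \<Rightarrow> real" and M \<rho> c' \<C> :: real and f :: "real \<Rightarrow> real"
  assumes N_pos: "N > 0"
    and n_less: "\<And>i j. i < j \<Longrightarrow> j < N \<Longrightarrow> n i < n j"
    and n_less_M: "n (N - 1) < M"
    and n_nonneg: "\<And>j. j < N \<Longrightarrow> 0 \<le> n j"
    and n_range: "\<And>j. j < N \<Longrightarrow> n j \<in> \<nat> \<union> {real N - 2..}"
    and rho_pos: "\<rho> > 0"
    and f_eq: "f = (\<lambda>x. (\<Sum>j<N. c j * rpow x (n j)) + c' * rpow x M)"
    and C_eq: "\<C> = (\<Sum>j<N. (vandermonde (map n ([0..<j] @ [Suc j..<N]) @ [M]))\<^sup>2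
                         / (vandermonde (map n [0..<N]))\<^sup>2 * (\<rho> powr (M - n j) / c j))"
  defines "cond1 \<equiv> preserves_TN f (HTN_rank1 N {0<..<\<rho>})"
    and "cond2 \<equiv> preserves_positivity f (HTN_rank1 N {0<..<\<rho>})"
    and "cond3 \<equiv> ((\<forall>j<N. 0 \<le> c j) \<and> 0 \<le> c') \<or> ((\<forall>j<N. 0 < c j) \<and> - inverse \<C> \<le> c')"
    and "cond4 \<equiv> preserves_TN f (HTN N {0..\<rho>})"
  shows "(cond1 \<longleftrightarrow> cond2) \<and> (cond2 \<longleftrightarrow> cond3) \<and> (cond3 \<longleftrightarrow> cond4)"
proof -
  have nM: "n j < M" if "j < N" for j
  proof -
    have "j < N - 1 \<or> j = N - 1" using that by linarith
    then show ?thesis using n_less[of j "N - 1"] n_less_M N_pos by auto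
  qed
  have inj: "inj_on n {..<N}"
    by (rule linorder_inj_onI) (use n_less in fastforce)+
  have C: "\<C> = rank_one_cost {..<N} n c M \<rho>"
    unfolding C_eq rank_one_cost_def using vandermonde_ratio[OF inj] by (intro sum.cong refl) simp
  have C_pos: "\<C> > 0" if "\<forall>j<N. 0 < c j"
  proof -
    have "lagrange {..<N} n j M \<noteq> 0" if "j < N" for j
    proof -
      have "(M - n i) / (n j - n i) \<noteq> 0" if "i \<in> {..<N} - {j}" for i
        using nM[of i] inj \<open>j < N\<close> that by (auto simp: inj_on_def)
      then show ?thesis by (simp add: lagrange_def)
    qed
    then show ?thesis
      unfolding C rank_one_cost_def using N_pos that rho_pos by (intro sum_pos) auto
  qed
  (* Positivity of the constant allows the threshold to be read multiplicatively. *)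
  have threshold: "- inverse \<C> \<le> c' \<longleftrightarrow> 0 \<le> 1 + c' * \<C>" if "\<forall>j<N. 0 < c j"
    using C_pos[OF that] by (auto simp: field_simps)
  have "cond1 \<Longrightarrow> cond2"
    unfolding cond1_def cond2_def
    by (rule preserves_TN_imp_positivity[of _ N "{0<..<\<rho>}"]) (auto simp: HTN_rank1_def)
  moreover have "cond2 \<Longrightarrow> cond3"
  proof -
    assume c2: cond2
    note pp = c2[unfolded cond2_def]
    have nonneg: "0 \<le> c j" if "j < N" for j
      by (rule preserver_coefficient_nonneg[OF f_eq pp n_less nM rho_pos that])
    show cond3
    proof (cases "0 \<le> c'")
      case True
      then show ?thesis using nonneg by (simp add: cond3_def)
    next
      case False
      then have pos: "0 < c j" if "j < N" for j
        using nonneg[OF that] preserver_coefficient_nonzero[OF f_eq pp nM rho_pos _ that] by simp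
      have "0 \<le> 1 + c' * \<C>"
        unfolding C by (rule preserver_threshold[OF f_eq pp N_pos inj nM pos rho_pos])
      then show ?thesis using pos threshold by (simp add: cond3_def)
    qed
  qed
  moreover have "cond3 \<Longrightarrow> cond4"
  proof -
    assume cond3
    then have cond: "((\<forall>j<N. 0 \<le> c j) \<and> 0 \<le> c') \<or> ((\<forall>j<N. 0 < c j) \<and> 0 \<le> 1 + c' * rank_one_cost {..<N} n c M \<rho>)"
      unfolding cond3_def using threshold C by auto
    show cond4
      unfolding cond4_def preserves_TN_def
      by (intro ballI map_mat_hankel_TN[where N = N, OF _ rho_pos]
            entrywise_psd_closed_interval[OF f_eq N_pos n_less n_less_M n_nonneg n_range rho_pos cond])
  qed
  moreover have "cond4 \<Longrightarrow> cond1"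
  proof -
    assume cond4
    moreover have "HTN_rank1 N {0<..<\<rho>} \<subseteq> HTN N {0..\<rho>}"
      by (auto simp: HTN_rank1_def HTN_def)
    ultimately show cond1 unfolding cond1_def cond4_def preserves_TN_def by blast
  qed
  ultimately show ?thesis by blast
qed

end
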